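(* Let $C: f=0$ be a reduced plane curve of degree $d\geq 3$ in $\mathbb{P}^2$ over $\mathbb{C}$, which is an $m$-syzygy curve with exponents $1\leq d_1\leq d_2\leq\cdots\leq d_m$. Then $m$, the cardinality of a minimal set of generators of the module $AR(f)$ of Jacobian syzygies, satisfies $$m\leq d_1+d_2-d+3\leq d_1+2\leq d+1.$$
   Context: Let $S=\mathbb{C}[x,y,z]$ with its standard grading, and let $C:f=0$ be a reduced curve of degree $d$ in the complex projective plane $\mathbb{P}^2$, where $f\in S$ is a homogeneous polynomial of degree $d$ without multiple factors; $f_x,f_y,f_z$ are its partial derivatives. The graded $S$-module of Jacobian syzygies is $$AR(f)=\{(a,b,c)\in S^3 : af_x+bf_y+cf_z=0\},$$ where a syzygy $(a,b,c)$ with $a,b,c$ homogeneous of degree $k$ has degree $k$. $C$ is called an $m$-syzygy curve if a minimal set of homogeneous generators $\rho_1,\dots,\rho_m$ of $AR(f)$ has exactly $m$ elements; the degrees $d_j=\deg\rho_j$, ordered so that $d_1\leq d_2\leq\cdots\leq d_m$, are called the exponents of $C$. (The case $d_1=0$ occurs exactly when $C$ is a union of lines through one point, and it is excluded.) One always has $m\geq 2$. *)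

theory Defs
  imports
    "HOL-Computational_Algebra.Polynomial_Factorial"
    "HOL-Computational_Algebra.Squarefree"
    "HOL-Library.Product_Plus"
begin

text \<open>
  The ring \<open>S = \<complex>[x,y,z]\<close> is the iterated polynomial ring \<open>\<complex>[z][y][x]\<close>: the outermost
  variable is \<open>x\<close> and the innermost one is \<open>z\<close>.
\<close>

type_synonym S = "complex poly poly poly"

definition coeff3 :: "S \<Rightarrow> nat \<Rightarrow> nat \<Rightarrow> nat \<Rightarrow> complex"
  \<comment> \<open>coefficient of the monomial \<open>x ^ i * y ^ j * z ^ k\<close>\<close>
  where "coeff3 f i j k = coeff (coeff (coeff f i) j) k"

definition dx :: "S \<Rightarrow> S" where "dx f = pderiv f"
definition dy :: "S \<Rightarrow> S" where "dy f = map_poly pderiv f"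
definition dz :: "S \<Rightarrow> S" where "dz f = map_poly (map_poly pderiv) f"

lemma coeff3_dx: "coeff3 (dx f) i j k = of_nat (Suc i) * coeff3 f (Suc i) j k"
  by (simp add: coeff3_def dx_def coeff_pderiv of_nat_poly algebra_simps del: of_nat_Suc)

lemma coeff3_dy: "coeff3 (dy f) i j k = of_nat (Suc j) * coeff3 f i (Suc j) k"
  by (simp add: coeff3_def dy_def coeff_map_poly coeff_pderiv of_nat_poly del: of_nat_Suc)

lemma coeff3_dz: "coeff3 (dz f) i j k = of_nat (Suc k) * coeff3 f i j (Suc k)"
  by (simp add: coeff3_def dz_def coeff_map_poly coeff_pderiv del: of_nat_Suc)

text \<open>As usual, the zero polynomial is homogeneous of every degree.\<close>

definition homogeneous :: "nat \<Rightarrow> S \<Rightarrow> bool"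
  where "homogeneous d f \<longleftrightarrow> (\<forall>i j k. coeff3 f i j k \<noteq> 0 \<longrightarrow> i + j + k = d)"

definition scale3 :: "S \<Rightarrow> S \<times> S \<times> S \<Rightarrow> S \<times> S \<times> S"
  where "scale3 s = (\<lambda>(a, b, c). (s * a, s * b, s * c))"

global_interpretation S3: module scale3
  by unfold_locales (auto simp: scale3_def algebra_simps)

definition AR :: "S \<Rightarrow> (S \<times> S \<times> S) set"
  where "AR f = {(a, b, c). a * dx f + b * dy f + c * dz f = 0}"

lemma subspace_AR: "S3.subspace (AR f)"
  unfolding S3.subspace_def
proof (intro conjI ballI allI)
  show "0 \<in> AR f"
    by (simp add: AR_def zero_prod_def)
next
  fix u v assume "u \<in> AR f" "v \<in> AR f"
  moreover have "(a + a') * p + (b + b') * q + (c + c') * r =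
      (a * p + b * q + c * r) + (a' * p + b' * q + c' * r)" for a a' b b' c c' p q r :: S
    by (simp add: algebra_simps)
  ultimately show "u + v \<in> AR f"
    by (auto simp: AR_def)
next
  fix s u assume "u \<in> AR f"
  moreover have "s * a * p + s * b * q + s * c * r = s * (a * p + b * q + c * r)"
    for a b c p q r :: S
    by (simp add: algebra_simps)
  ultimately show "scale3 s u \<in> AR f"
    by (auto simp: AR_def scale3_def)
qed

definition homogeneous3 :: "nat \<Rightarrow> S \<times> S \<times> S \<Rightarrow> bool"
  where "homogeneous3 k = (\<lambda>(a, b, c). homogeneous k a \<and> homogeneous k b \<and> homogeneous k c)"

definition minimal_homogeneous_generators :: "S \<Rightarrow> (S \<times> S \<times> S) set \<Rightarrow> bool"
  where "minimal_homogeneous_generators f G \<longleftrightarrow>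
    (\<forall>\<rho>\<in>G. \<exists>k. homogeneous3 k \<rho>) \<and>
    S3.span G = AR f \<and>
    (\<forall>H. H \<subset> G \<longrightarrow> S3.span H \<noteq> AR f)"

text \<open>
  The exponents \<open>e 1 \<le> \<dots> \<le> e m\<close> are indexed by \<open>{1..m}\<close>; values of \<open>e\<close> outside this range are
  irrelevant. By minimality no generator is zero, so its degree is well defined.
\<close>

definition syzygy_curve :: "S \<Rightarrow> nat \<Rightarrow> (nat \<Rightarrow> nat) \<Rightarrow> bool"
  where "syzygy_curve f m e \<longleftrightarrow>
    (\<exists>\<rho>. inj_on \<rho> {1..m} \<and> minimal_homogeneous_generators f (\<rho> ` {1..m}) \<and>
         (\<forall>j\<in>{1..m}. homogeneous3 (e j) (\<rho> j))) \<and>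
    mono_on {1..m} e"

end

theory Submission
  imports Defs "HOL-Computational_Algebra.Field_as_Ring"
begin

text \<open>
  The gradient of \<open>f\<close> has no common factor and the first generator \<open>\<rho>\<^sub>1\<close> is primitive, so
  \<open>\<rho>\<^sub>1 \<times> \<rho>\<^sub>2 = h \<nabla>f\<close> with \<open>h \<noteq> 0\<close> homogeneous of degree \<open>s = d\<^sub>1 + d\<^sub>2 - (d - 1)\<close>,
  and it suffices to show \<open>m - 2 \<le> s\<close>. Writing \<open>\<rho>\<^sub>1 \<times> \<rho> = u \<nabla>f\<close> embeds
  \<open>M = AR(f) / (\<rho>\<^sub>1, \<rho>\<^sub>2)\<close> into \<open>S / (h)\<close>. After a linear change of coordinates
  \<open>\<rho>\<^sub>1\<close> and \<open>\<rho>\<^sub>2\<close> are independent at the point \<open>(1 : 0 : 0)\<close>, which makes \<open>y, z\<close> a regular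
  sequence on \<open>M\<close>. By minimality \<open>\<rho>\<^sub>3, \<dots>, \<rho>\<^sub>m\<close> are linearly independent in
  \<open>M / (y, z) M\<close>, hence independent over \<open>\<complex>[y, z]\<close> in \<open>M\<close>; but more than \<open>s\<close> elements of
  \<open>S / (h)\<close> are always dependent over \<open>\<complex>[y, z]\<close>, because \<open>h\<close> has degree at most \<open>s\<close> in \<open>x\<close>.
  The bound \<open>d\<^sub>2 \<le> d - 1\<close> holds because the Koszul syzygies of degree \<open>d - 1\<close> are not all
  multiples of \<open>\<rho>\<^sub>1\<close>.
\<close>

section \<open>Evaluation homomorphisms and linear changes of coordinates\<close>

locale ring_map =
  fixes \<phi> :: "'a::comm_ring_1 \<Rightarrow> 'b::comm_ring_1"
  assumes add: "\<phi> (a + b) = \<phi> a + \<phi> b"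
    and mult: "\<phi> (a * b) = \<phi> a * \<phi> b"
    and one: "\<phi> 1 = 1"
begin

lemma zero: "\<phi> 0 = 0"
  using add[of 0 0] by simp

lemma uminus: "\<phi> (- a) = - \<phi> a"
  using add[of a "- a"] by (simp add: zero add_eq_0_iff)

lemma diff: "\<phi> (a - b) = \<phi> a - \<phi> b"
  using add[of a "- b"] by (simp add: uminus)

lemma sum: "\<phi> (sum f I) = (\<Sum>i\<in>I. \<phi> (f i))"
  by (induction I rule: infinite_finite_induct) (auto simp: zero add)

lemma ring_map_map_poly: "ring_map (map_poly \<phi>)"
proof
  fix p q :: "'a poly"
  show "map_poly \<phi> (p + q) = map_poly \<phi> p + map_poly \<phi> q"
    by (simp add: poly_eq_iff coeff_map_poly zero add)
  show "map_poly \<phi> (p * q) = map_poly \<phi> p * map_poly \<phi> q"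
    by (simp add: poly_eq_iff coeff_map_poly zero coeff_mult sum mult)
  show "map_poly \<phi> 1 = 1"
    by (simp add: one)
qed

lemma poly_map_poly_eq_sum: "poly (map_poly \<phi> p) b = (\<Sum>i\<le>degree p. \<phi> (coeff p i) * b ^ i)"
proof -
  have "poly (map_poly \<phi> p) b = (\<Sum>i\<le>degree p. coeff (map_poly \<phi> p) i * b ^ i)"
    unfolding poly_altdef
    using map_poly_degree_leq[of \<phi> p]
    by (intro sum.mono_neutral_left) (auto simp: coeff_eq_0)
  then show ?thesis
    by (simp add: coeff_map_poly zero)
qed

end

lemma ring_map_comp: "ring_map f \<Longrightarrow> ring_map g \<Longrightarrow> ring_map (\<lambda>x. g (f x))"
  unfolding ring_map_def by auto

lemma ring_map_poly: "ring_map (\<lambda>p. poly p x)"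
  by unfold_locales auto

lemma ring_map_eval: "ring_map \<phi> \<Longrightarrow> ring_map (\<lambda>p. poly (map_poly \<phi> p) x)"
  by (rule ring_map_comp[OF ring_map.ring_map_map_poly ring_map_poly])

text \<open>The ring homomorphism out of \<open>S\<close> that extends \<open>\<phi>\<close> and
  sends x, y, z to \<open>X\<close>, \<open>Y\<close>, \<open>Z\<close>. The nesting follows that of
  \<open>S\<close>, so the innermost variable z is substituted first.\<close>

definition eval3 :: "(complex \<Rightarrow> 'a::comm_ring_1) \<Rightarrow> 'a \<Rightarrow> 'a \<Rightarrow> 'a \<Rightarrow> S \<Rightarrow> 'a"
  where "eval3 \<phi> X Y Z p =
    poly (map_poly (\<lambda>c. poly (map_poly (\<lambda>d. poly (map_poly \<phi> d) Z) c) Y) p) X"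

lemma ring_map_eval3:
  assumes "ring_map \<phi>"
  shows "ring_map (eval3 \<phi> X Y Z)"
  unfolding eval3_def[abs_def] by (intro ring_map_eval assms)

lemma eval3_eq_sum:
  assumes "ring_map \<phi>"
  shows "eval3 \<phi> X Y Z p = (\<Sum>i\<le>degree p. \<Sum>j\<le>degree (coeff p i).
    \<Sum>k\<le>degree (coeff (coeff p i) j). \<phi> (coeff3 p i j k) * Z ^ k * Y ^ j * X ^ i)"
proof -
  note 1 = assms ring_map_eval[OF assms] ring_map_eval[OF ring_map_eval[OF assms]]
  show ?thesis
    unfolding eval3_def
    unfolding ring_map.poly_map_poly_eq_sum[OF 1(3)]
    unfolding ring_map.poly_map_poly_eq_sum[OF 1(2)]
    unfolding ring_map.poly_map_poly_eq_sum[OF 1(1)]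
    by (simp add: sum_distrib_right coeff3_def)
qed

definition const3 :: "complex \<Rightarrow> S" where "const3 c = [:[:[:c:]:]:]"
definition varx :: S where "varx = [:0, 1:]"
definition vary :: S where "vary = [:[:0, 1:]:]"
definition varz :: S where "varz = [:[:[:0, 1:]:]:]"

lemma ring_map_const3: "ring_map const3"
  by unfold_locales (auto simp: const3_def pCons_one)

text \<open>Constants and variables generate \<open>S\<close> as a ring, and by Horner's scheme
  products with a single variable suffice. The three inductions treat polynomials in z, then in y
  and z, then in all variables.\<close>

lemma S_induct [case_names const3 add varx vary varz]:
  assumes const3: "\<And>c. P (const3 c)"
    and add: "\<And>p q. P p \<Longrightarrow> P q \<Longrightarrow> P (p + q)"
    and var: "\<And>p. P p \<Longrightarrow> P (varx * p)" "\<And>p. P p \<Longrightarrow> P (vary * p)" "\<And>p. P p \<Longrightarrow> P (varz * p)"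
  shows "P p"
proof -
  have 0: "P 0" using const3[of 0] by (simp add: const3_def)
  have 1: "P [:[:r:]:]" for r
  proof (induction r)
    case (pCons c r)
    have "[:[:pCons c r:]:] = const3 c + varz * [:[:r:]:]"
      by (simp add: const3_def varz_def)
    with pCons const3 add var show ?case by metis
  qed (use 0 in simp)
  have 2: "P [:r:]" for r
  proof (induction r)
    case (pCons c r)
    have "[:pCons c r:] = [:[:c:]:] + vary * [:r:]"
      by (simp add: vary_def)
    with pCons 1 add var show ?case by metis
  qed (use 0 in simp)
  show ?thesis
  proof (induction p)
    case (pCons c r)
    have "pCons c r = [:c:] + varx * r"
      by (simp add: varx_def)
    with pCons 2 add var show ?case by metis
  qed (use 0 in simp)
qed

lemma ring_map_S_eqI:
  fixes f g :: "S \<Rightarrow> 'a::comm_ring_1"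
  assumes "ring_map f" "ring_map g"
    and "\<And>c. f (const3 c) = g (const3 c)" "f varx = g varx" "f vary = g vary" "f varz = g varz"
  shows "f p = g p"
  by (induction p rule: S_induct)
    (simp_all add: assms ring_map.add[OF assms(1)] ring_map.add[OF assms(2)]
      ring_map.mult[OF assms(1)] ring_map.mult[OF assms(2)])

lemma eval3_simps:
  assumes "ring_map \<phi>"
  shows "eval3 \<phi> X Y Z (const3 c) = \<phi> c" "eval3 \<phi> X Y Z varx = X"
    "eval3 \<phi> X Y Z vary = Y" "eval3 \<phi> X Y Z varz = Z"
  unfolding eval3_def const3_def varx_def vary_def varz_def
  by (simp_all add: map_poly_pCons ring_map.zero[OF assms] ring_map.one[OF assms])

text \<open>A linear change of coordinates: the value of \<open>shear \<alpha> \<beta> p\<close> at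
  (1, 0, 0) is the value of \<open>p\<close> at (1, \<alpha>, \<beta>).\<close>

definition shear :: "complex \<Rightarrow> complex \<Rightarrow> S \<Rightarrow> S"
  where "shear \<alpha> \<beta> = eval3 const3 varx (vary + const3 \<alpha> * varx) (varz + const3 \<beta> * varx)"

lemma ring_map_shear: "ring_map (shear \<alpha> \<beta>)"
  unfolding shear_def by (intro ring_map_eval3 ring_map_const3)

lemma shear_simps:
  "shear \<alpha> \<beta> (const3 c) = const3 c" "shear \<alpha> \<beta> varx = varx"
  "shear \<alpha> \<beta> vary = vary + const3 \<alpha> * varx" "shear \<alpha> \<beta> varz = varz + const3 \<beta> * varx"
  by (simp_all add: shear_def eval3_simps ring_map_const3)

lemma shear_shear_uminus: "shear \<alpha> \<beta> (shear (- \<alpha>) (- \<beta>) p) = p"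
proof (rule ring_map_S_eqI)
  show "ring_map (\<lambda>p. shear \<alpha> \<beta> (shear (- \<alpha>) (- \<beta>) p))"
    by (intro ring_map_comp[OF ring_map_shear ring_map_shear])
  show "ring_map (\<lambda>p :: S. p)"
    by unfold_locales auto
qed (simp_all add: shear_simps ring_map.add[OF ring_map_shear] ring_map.mult[OF ring_map_shear]
      ring_map.diff[OF ring_map_shear] ring_map.uminus[OF ring_map_const3])

lemma shear_uminus_shear: "shear (- \<alpha>) (- \<beta>) (shear \<alpha> \<beta> p) = p"
  using shear_shear_uminus[of "- \<alpha>" "- \<beta>"] by simp

text \<open>Each variable goes to a linear form, so a monomial of total degree n acquires degree at
  most n in x. This later bounds the x-degree of the transformed \<open>h\<close>.\<close>

lemma degree_shear_le:
  assumes "homogeneous n p"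
  shows "degree (shear \<alpha> \<beta> p) \<le> n"
proof -
  have 1: "degree (const3 c * (varz + const3 \<beta> * varx) ^ k * (vary + const3 \<alpha> * varx) ^ j * varx ^ i)
      \<le> i + j + k" for c i j k
  proof -
    have z: "degree (varz + const3 \<beta> * varx) \<le> 1" and y: "degree (vary + const3 \<alpha> * varx) \<le> 1"
      by (auto simp: varz_def vary_def varx_def const3_def)
    have "degree ((varz + const3 \<beta> * varx) ^ k) \<le> k"
      by (rule order.trans[OF degree_power_le]) (use mult_le_mono1[OF z, of k] in simp)
    moreover have "degree ((vary + const3 \<alpha> * varx) ^ j) \<le> j"
      by (rule order.trans[OF degree_power_le]) (use mult_le_mono1[OF y, of j] in simp)
    moreover have "degree (varx ^ i) \<le> i"
      using degree_power_le[of varx i] by (simp add: varx_def)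
    moreover have "degree (const3 c) = 0"
      by (simp add: const3_def)
    ultimately show ?thesis
      using degree_mult_le[of "const3 c" "(varz + const3 \<beta> * varx) ^ k"]
        degree_mult_le[of "const3 c * (varz + const3 \<beta> * varx) ^ k" "(vary + const3 \<alpha> * varx) ^ j"]
        degree_mult_le[of "const3 c * (varz + const3 \<beta> * varx) ^ k * (vary + const3 \<alpha> * varx) ^ j"
          "varx ^ i"]
      by linarith
  qed
  show ?thesis
    unfolding shear_def eval3_eq_sum[OF ring_map_const3]
  proof (intro degree_sum_le finite_atMost)
    fix i j k
    show "degree (const3 (coeff3 p i j k) * (varz + const3 \<beta> * varx) ^ k *
        (vary + const3 \<alpha> * varx) ^ j * varx ^ i) \<le> n"
    proof (cases "coeff3 p i j k = 0")
      case False
      with assms have "i + j + k = n"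
        by (auto simp: homogeneous_def)
      with 1[of "coeff3 p i j k" k j i] show ?thesis by simp
    qed (simp add: const3_def)
  qed
qed

section \<open>Restriction to the line y = z = 0\<close>

definition restrict_x :: "S \<Rightarrow> complex poly"
  where "restrict_x = map_poly (\<lambda>c. poly (poly c 0) 0)"

lemma ring_map_restrict_x: "ring_map restrict_x"
  unfolding restrict_x_def
  by (intro ring_map.ring_map_map_poly ring_map_comp[OF ring_map_poly ring_map_poly])

lemma finite_const_roots:
  fixes p :: "'a::idom poly poly"
  assumes "p \<noteq> 0"
  shows "finite {a. poly p [:a:] = 0}"
proof (rule finite_imageD)
  show "finite ((\<lambda>a. [:a:]) ` {a. poly p [:a:] = 0})"
    by (rule finite_subset[OF _ poly_roots_finite[OF assms]]) auto
qed (auto simp: inj_on_def)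

text \<open>The field is infinite, so \<open>p\<close> is nonzero at some point (a, b, c) with a
  \<noteq> 0. The shear by b/a and c/a carries the line y = z = 0 to the line through the origin and
  that point.\<close>

lemma exists_shear_restrict_x_nonzero:
  assumes "p \<noteq> 0"
  shows "\<exists>\<alpha> \<beta>. restrict_x (shear \<alpha> \<beta> p) \<noteq> 0"
proof -
  have inf: "infinite (UNIV :: complex set)"
    by (rule infinite_UNIV_char_0)
  have fin: "finite {a. poly p [:[:a:]:] = 0}"
  proof (rule finite_imageD)
    show "finite ((\<lambda>a. [:[:a:]:]) ` {a. poly p [:[:a:]:] = 0})"
      by (rule finite_subset[OF _ poly_roots_finite[OF assms]]) auto
  qed (auto simp: inj_on_def)
  \<comment> \<open>Zero is excluded as well, because the shear divides by \<open>a\<close>.\<close>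
  then have "finite (insert 0 {a. poly p [:[:a:]:] = 0})"
    by simp
  then obtain a where a: "a \<noteq> 0" "poly p [:[:a:]:] \<noteq> 0"
    using ex_new_if_finite[OF inf] by blast
  obtain b where b: "poly (poly p [:[:a:]:]) [:b:] \<noteq> 0"
    using ex_new_if_finite[OF inf finite_const_roots[OF a(2)]] by blast
  obtain c where c: "poly (poly (poly p [:[:a:]:]) [:b:]) c \<noteq> 0"
    using ex_new_if_finite[OF inf poly_roots_finite[OF b]] by blast
  \<comment> \<open>Both sides are ring homomorphisms in \<open>q\<close>, so it suffices to compare
    them on constants and variables.\<close>
  have "poly (restrict_x (shear (b / a) (c / a) q)) a = poly (poly (poly q [:[:a:]:]) [:b:]) c" for q
  proof (rule ring_map_S_eqI[of "\<lambda>q. poly (restrict_x (shear (b / a) (c / a) q)) a"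
        "\<lambda>q. poly (poly (poly q [:[:a:]:]) [:b:]) c"])
    show "ring_map (\<lambda>q. poly (restrict_x (shear (b / a) (c / a) q)) a)"
      by (intro ring_map_comp[OF ring_map_comp[OF ring_map_shear ring_map_restrict_x] ring_map_poly])
    show "ring_map (\<lambda>q. poly (poly (poly q [:[:a:]:]) [:b:]) c)"
      by unfold_locales auto
  qed (use a in \<open>simp_all add: shear_simps ring_map.add[OF ring_map_restrict_x]
        ring_map.mult[OF ring_map_restrict_x]\<close>, simp_all add: restrict_x_def varx_def vary_def varz_def const3_def map_poly_pCons)
  with c have "poly (restrict_x (shear (b / a) (c / a) p)) a \<noteq> 0"
    by simp
  then show ?thesis
    by (metis poly_0)
qed

section \<open>Linear dependence and determinants\<close>

text \<open>Gaussian elimination without division, valid over any integral domain: a vector with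
  nonzero last entry serves as pivot, and clearing that entry in the others costs one vector and one
  entry.\<close>

lemma exists_nontrivial_relation:
  fixes v :: "'j \<Rightarrow> nat \<Rightarrow> 'a::idom"
  assumes "finite J" "n < card J"
  shows "\<exists>r. (\<exists>j\<in>J. r j \<noteq> 0) \<and> (\<forall>i<n. (\<Sum>j\<in>J. r j * v j i) = 0)"
  using assms
proof (induction n arbitrary: J v)
  case 0
  then obtain j where "j \<in> J" by fastforce
  then show ?case by (intro exI[of _ "\<lambda>_. 1"]) auto
next
  case (Suc n)
  show ?case
  proof (cases "\<forall>j\<in>J. v j n = 0")
    case True
    with Suc.IH[of J v] Suc.prems show ?thesis
      by (auto simp: less_Suc_eq)
  next
    case False
    then obtain l where l: "l \<in> J" "v l n \<noteq> 0" by blast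
    define w where "w j i = v l n * v j i - v j n * v l i" for j i
    obtain r where r: "\<exists>j\<in>J - {l}. r j \<noteq> 0" "\<And>i. i < n \<Longrightarrow> (\<Sum>j\<in>J - {l}. r j * w j i) = 0"
    proof -
      have "finite (J - {l})" "n < card (J - {l})"
        using Suc.prems l by auto
      from Suc.IH[OF this, of w] that show thesis by blast
    qed
    \<comment> \<open>The coefficient of the pivot is chosen so that entry \<open>n\<close> of the
      combination vanishes.\<close>
    define r' where "r' j = (if j = l then - (\<Sum>j\<in>J - {l}. r j * v j n) else v l n * r j)" for j
    have "(\<Sum>j\<in>J. r' j * v j i) = (\<Sum>j\<in>J - {l}. r j * w j i)" for i
    proof -
      have "(\<Sum>j\<in>J. r' j * v j i) = r' l * v l i + (\<Sum>j\<in>J - {l}. r' j * v j i)"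
        using l Suc.prems by (simp add: sum.remove)
      also have "\<dots> = v l n * (\<Sum>j\<in>J - {l}. r j * v j i) - v l i * (\<Sum>j\<in>J - {l}. r j * v j n)"
      proof -
        have "(\<Sum>j\<in>J - {l}. r' j * v j i) = v l n * (\<Sum>j\<in>J - {l}. r j * v j i)"
          unfolding sum_distrib_left by (intro sum.cong) (auto simp: r'_def)
        then show ?thesis by (simp add: r'_def)
      qed
      also have "\<dots> = (\<Sum>j\<in>J - {l}. r j * w j i)"
        by (simp add: w_def sum_distrib_left sum_subtractf right_diff_distrib mult_ac)
      finally show ?thesis .
    qed
    moreover have "(\<Sum>j\<in>J - {l}. r j * w j n) = 0"
      by (simp add: w_def mult.commute)
    moreover have "\<exists>j\<in>J. r' j \<noteq> 0"
      using r(1) l by (auto simp: r'_def)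
    ultimately show ?thesis
      using r(2) by (intro exI[of _ r']) (auto simp: less_Suc_eq)
  qed
qed

text \<open>Pseudo-division replaces each \<open>u j\<close>, up to the nonzero factor
  \<open>l j\<close>, by a remainder with only \<open>degree h\<close> coefficients. More than
  \<open>degree h\<close> such coefficient vectors are dependent.\<close>

lemma exists_combination_dvd:
  fixes u :: "'j \<Rightarrow> 'a::idom poly"
  assumes "finite J" "degree h < card J" "h \<noteq> 0"
  shows "\<exists>r. (\<exists>j\<in>J. r j \<noteq> 0) \<and> h dvd (\<Sum>j\<in>J. [:r j:] * u j)"
proof -
  define l where "l j = lead_coeff h ^ (Suc (degree (u j)) - degree h)" for j
  define q where "q j = fst (pseudo_divmod (u j) h)" for j
  define v where "v j = snd (pseudo_divmod (u j) h)" for j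
  have 1: "[:l j:] * u j = h * q j + v j" for j
    using pseudo_divmod(1)[OF assms(3), of "u j" "q j" "v j"] by (simp add: l_def q_def v_def)
  have 2: "v j = 0 \<or> degree (v j) < degree h" for j
    using pseudo_divmod(2)[OF assms(3), of "u j" "q j" "v j"] by (simp add: q_def v_def)
  obtain r where r: "\<exists>j\<in>J. r j \<noteq> 0" "\<And>i. i < degree h \<Longrightarrow> (\<Sum>j\<in>J. r j * coeff (v j) i) = 0"
    using exists_nontrivial_relation[OF assms(1,2), of "\<lambda>j. coeff (v j)"] by blast
  have "(\<Sum>j\<in>J. [:r j:] * v j) = 0"
  proof (rule poly_eqI)
    fix i
    show "coeff (\<Sum>j\<in>J. [:r j:] * v j) i = coeff 0 i"
    proof (cases "i < degree h")
      case False
      with 2 have "coeff (v j) i = 0" for j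
        by (metis coeff_0 coeff_eq_0 leI less_le_trans)
      then show ?thesis
        by (simp add: coeff_sum)
    qed (use r in \<open>simp add: coeff_sum\<close>)
  qed
  moreover have "[:r j * l j:] * u j = h * ([:r j:] * q j) + [:r j:] * v j" for j
  proof -
    have "[:r j * l j:] * u j = [:r j:] * ([:l j:] * u j)" by (simp add: mult.commute)
    also have "\<dots> = h * ([:r j:] * q j) + [:r j:] * v j"
      unfolding 1 by (simp add: algebra_simps)
    finally show ?thesis .
  qed
  ultimately have "(\<Sum>j\<in>J. [:r j * l j:] * u j) = h * (\<Sum>j\<in>J. [:r j:] * q j)"
    by (simp only: sum.distrib sum_distrib_left add_0_right)
  then have "h dvd (\<Sum>j\<in>J. [:r j * l j:] * u j)"
    by (metis dvd_triv_left)
  moreover have "\<exists>j\<in>J. r j * l j \<noteq> 0"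
    using r(1) assms(3) by (auto simp: l_def)
  ultimately show ?thesis by (intro exI[of _ "\<lambda>j. r j * l j"]) auto
qed

text \<open>The determinant turns a combination \<open>a v + b w\<close> into either of its coefficients.\<close>

definition det3 :: "S \<times> S \<times> S \<Rightarrow> S \<times> S \<times> S \<Rightarrow> S \<times> S \<times> S \<Rightarrow> S"
  where "det3 = (\<lambda>(a, b, c) (a', b', c') (a'', b'', c'').
    a * (b' * c'' - c' * b'') + b * (c' * a'' - a' * c'') + c * (a' * b'' - b' * a''))"

lemma det3_add: "det3 t v (x + y) = det3 t v x + det3 t v y"
  by (cases t; cases v; cases x; cases y) (simp add: det3_def algebra_simps)

lemma det3_diff: "det3 t v (x - y) = det3 t v x - det3 t v y"
  by (cases t; cases v; cases x; cases y) (simp add: det3_def algebra_simps)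

lemma det3_scale3: "det3 t v (scale3 s x) = s * det3 t v x"
  by (cases t; cases v; cases x) (simp add: det3_def scale3_def algebra_simps)

lemma det3_sum: "det3 t v (\<Sum>i\<in>I. x i) = (\<Sum>i\<in>I. det3 t v (x i))"
  by (induction I rule: infinite_finite_induct)
    (auto simp: det3_add, auto simp: det3_def zero_prod_def split: prod.split)

lemma det3_same: "det3 t v v = 0"
  by (cases t; cases v) (simp add: det3_def algebra_simps)

lemma det3_swap: "det3 t w v = - det3 t v w"
  by (cases t; cases v; cases w) (simp add: det3_def algebra_simps)

lemma scale3_cancel_left: "s \<noteq> 0 \<Longrightarrow> scale3 s v = scale3 s w \<longleftrightarrow> v = w"
  by (cases v; cases w) (auto simp: scale3_def)

definition map3 :: "(S \<Rightarrow> S) \<Rightarrow> S \<times> S \<times> S \<Rightarrow> S \<times> S \<times> S"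
  where "map3 \<phi> = (\<lambda>(a, b, c). (\<phi> a, \<phi> b, \<phi> c))"

lemma map3_add: "ring_map \<phi> \<Longrightarrow> map3 \<phi> (v + w) = map3 \<phi> v + map3 \<phi> w"
  by (cases v; cases w) (simp add: map3_def ring_map.add)

lemma map3_zero: "ring_map \<phi> \<Longrightarrow> map3 \<phi> 0 = 0"
  by (simp add: map3_def ring_map.zero zero_prod_def)

lemma map3_scale3: "ring_map \<phi> \<Longrightarrow> map3 \<phi> (scale3 s v) = scale3 (\<phi> s) (map3 \<phi> v)"
  by (cases v) (simp add: map3_def scale3_def ring_map.mult)

lemma map3_sum: "ring_map \<phi> \<Longrightarrow> map3 \<phi> (\<Sum>i\<in>I. x i) = (\<Sum>i\<in>I. map3 \<phi> (x i))"
  by (induction I rule: infinite_finite_induct) (auto simp: map3_add map3_zero)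

lemma det3_map3:
  assumes "ring_map \<phi>"
  shows "det3 (map3 \<phi> t) (map3 \<phi> v) (map3 \<phi> w) = \<phi> (det3 t v w)"
proof -
  interpret ring_map \<phi> by fact
  show ?thesis
    by (cases t; cases v; cases w) (simp add: det3_def map3_def add mult diff)
qed

section \<open>Reduction modulo y and modulo (y, z)\<close>

definition restrict_xz :: "S \<Rightarrow> complex poly poly"
  where "restrict_xz = map_poly (\<lambda>c. poly c 0)"

lemma ring_map_restrict_xz: "ring_map restrict_xz"
  unfolding restrict_xz_def by (intro ring_map.ring_map_map_poly ring_map_poly)

lemma restrict_x_restrict_xz: "restrict_x p = map_poly (\<lambda>c. poly c 0) (restrict_xz p)"
  by (simp add: restrict_x_def restrict_xz_def poly_eq_iff coeff_map_poly)

lemma restrict_vars: "restrict_xz vary = 0" "restrict_x vary = 0" "restrict_x varz = 0"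
  by (simp_all add: restrict_xz_def restrict_x_def vary_def varz_def map_poly_pCons)

lemma restrict_xz_eq_0D:
  assumes "restrict_xz p = 0"
  shows "\<exists>q. p = vary * q"
proof -
  have "poly (coeff p i) 0 = 0" for i
    using assms by (simp add: restrict_xz_def poly_eq_iff coeff_map_poly)
  then have "coeff p i = [:0, 1:] * poly_shift 1 (coeff p i)" for i
    by (auto simp: poly_eq_iff coeff_pCons coeff_poly_shift poly_0_coeff_0 split: nat.split)
  then have "p = vary * map_poly (poly_shift 1) p"
    by (auto simp: poly_eq_iff vary_def coeff_map_poly)
  then show ?thesis by blast
qed

lemma restrict_x_eq_0D:
  assumes "restrict_x p = 0"
  shows "\<exists>q r. p = vary * q + varz * r"
proof -
  \<comment> \<open>\<open>p0\<close> collects the terms of \<open>p\<close> free of y, and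
    \<open>r\<close> is the quotient of \<open>p0\<close> by z.\<close>
  define p0 where "p0 = map_poly (\<lambda>c. [:poly c 0:]) p"
  define r where "r = map_poly (\<lambda>c. [:poly_shift 1 (poly c 0):]) p"
  have "restrict_xz (p - p0) = 0"
    by (simp add: restrict_xz_def poly_eq_iff coeff_map_poly p0_def)
  then obtain q where q: "p - p0 = vary * q"
    using restrict_xz_eq_0D by blast
  have "poly (poly (coeff p i) 0) 0 = 0" for i
    using assms by (simp add: restrict_x_def poly_eq_iff coeff_map_poly)
  then have "poly (coeff p i) 0 = [:0, 1:] * poly_shift 1 (poly (coeff p i) 0)" for i
    by (auto simp: poly_eq_iff coeff_pCons coeff_poly_shift poly_0_coeff_0 split: nat.split)
  then have "p0 = varz * r"
    by (auto simp: poly_eq_iff varz_def coeff_map_poly p0_def r_def coeff_pCons split: nat.split)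
  with q show ?thesis
    by (metis diff_add_cancel)
qed

text \<open>Modulo y the ring is still a domain, and z is nonzero there.\<close>

lemma vary_varz_coprime:
  assumes "varz * p = vary * q"
  shows "\<exists>r. p = vary * r"
proof -
  interpret ring_map restrict_xz by (rule ring_map_restrict_xz)
  have "restrict_xz varz * restrict_xz p = 0"
    using arg_cong[OF assms, of restrict_xz] by (simp add: mult restrict_vars)
  moreover have "restrict_xz varz \<noteq> 0"
    by (simp add: restrict_xz_def varz_def map_poly_pCons)
  ultimately show ?thesis
    using restrict_xz_eq_0D by simp
qed

section \<open>A regular sequence and independence over a polynomial subring\<close>

text \<open>In the application \<open>A\<close> is AR(f) in new coordinates and \<open>v\<close>,
  \<open>w\<close> are the first two generators. The condition \<open>det\<close> expresses their
  independence along the line y = z = 0, since \<open>det3 t v w\<close> is a combination of their 2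
  x 2 minors.\<close>

context
  fixes A :: "(S \<times> S \<times> S) set" and t v w :: "S \<times> S \<times> S"
  assumes A: "S3.subspace A" "\<And>x. scale3 varz x \<in> A \<Longrightarrow> x \<in> A"
    and v: "v \<in> A" and w: "w \<in> A"
    and det: "restrict_x (det3 t v w) \<noteq> 0"
begin

text \<open>Pairing with \<open>det3 t v\<close> and \<open>det3 t w\<close> isolates
  \<open>b\<close> and \<open>a\<close>, up to sign, times \<open>det3 t v w\<close>; the image of
  that factor cancels in a domain.\<close>

lemma coeff_restrict_eq_0:
  assumes "ring_map \<phi>" "\<phi> (det3 t v w) \<noteq> (0 :: 'a :: idom)"
    and "\<phi> (det3 t v (scale3 a v + scale3 b w)) = 0"
    and "\<phi> (det3 t w (scale3 a v + scale3 b w)) = 0"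
  shows "\<phi> a = 0" "\<phi> b = 0"
proof -
  interpret ring_map \<phi> by fact
  have "det3 t v (scale3 a v + scale3 b w) = b * det3 t v w"
    by (simp add: det3_add det3_scale3 det3_same)
  moreover have "det3 t w (scale3 a v + scale3 b w) = - (a * det3 t v w)"
    by (simp add: det3_add det3_scale3 det3_same det3_swap[of t w v])
  ultimately show "\<phi> a = 0" "\<phi> b = 0"
    using assms by (simp_all add: mult uminus)
qed

text \<open>That is, y is a nonzerodivisor modulo \<open>v\<close> and \<open>w\<close>. Reduction
  modulo y shows that y divides both coefficients, and then y cancels.\<close>

lemma vary_regular:
  assumes "scale3 vary x = scale3 a v + scale3 b w"
  shows "\<exists>a b. x = scale3 a v + scale3 b w"
proof -
  interpret ring_map restrict_xz by (rule ring_map_restrict_xz)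
  have 1: "restrict_xz (det3 t v w) \<noteq> 0"
    using det by (auto simp: restrict_x_restrict_xz)
  have "restrict_xz (det3 t u (scale3 a v + scale3 b w)) = 0" for u
    unfolding assms[symmetric] by (simp add: det3_scale3 mult restrict_vars)
  note coeff_restrict_eq_0[OF ring_map_restrict_xz 1 this this]
  then obtain a' b' where ab: "a = vary * a'" "b = vary * b'"
    using restrict_xz_eq_0D by blast
  have "scale3 vary x = scale3 vary (scale3 a' v + scale3 b' w)"
    unfolding assms ab by (simp add: S3.scale_right_distrib)
  then have "x = scale3 a' v + scale3 b' w"
    by (subst (asm) scale3_cancel_left) (auto simp: vary_def)
  then show ?thesis by blast
qed

text \<open>That is, z is a nonzerodivisor modulo y \<open>A\<close> and \<open>v\<close>,
  \<open>w\<close>. Reduction modulo (y, z) puts \<open>a\<close> and \<open>b\<close> into the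
  ideal (y, z); absorbing their parts leaves z x' = y y', where y must divide x'.\<close>

lemma varz_regular:
  assumes y: "y \<in> A" and eq: "scale3 varz x = scale3 vary y + scale3 a v + scale3 b w"
  shows "\<exists>y\<in>A. \<exists>a b. x = scale3 vary y + scale3 a v + scale3 b w"
proof -
  interpret ring_map restrict_x by (rule ring_map_restrict_x)
  have "scale3 a v + scale3 b w = scale3 varz x - scale3 vary y"
    using eq by simp
  then have "restrict_x (det3 t u (scale3 a v + scale3 b w)) = 0" for u
    by (simp add: det3_diff det3_scale3 diff mult restrict_vars)
  note 0 = coeff_restrict_eq_0[OF ring_map_restrict_x det this this]
  obtain a1 a2 where a: "a = vary * a1 + varz * a2"
    using restrict_x_eq_0D[OF 0(1)] by (elim exE)
  obtain b1 b2 where b: "b = vary * b1 + varz * b2"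
    using restrict_x_eq_0D[OF 0(2)] by (elim exE)
  define x' where "x' = x - scale3 a2 v - scale3 b2 w"
  define y' where "y' = y + scale3 a1 v + scale3 b1 w"
  have y': "y' \<in> A"
    unfolding y'_def by (intro S3.subspace_add S3.subspace_scale A(1) y v w)
  have *: "scale3 varz x' = scale3 vary y'"
    using eq unfolding a b x'_def y'_def
    by (simp add: algebra_simps)
  obtain x1 x2 x3 y1 y2 y3 where xy: "x' = (x1, x2, x3)" "y' = (y1, y2, y3)"
    by (metis prod_cases3)
  from * have "varz * x1 = vary * y1" "varz * x2 = vary * y2" "varz * x3 = vary * y3"
    by (auto simp: xy scale3_def)
  from this[THEN vary_varz_coprime]
  obtain z1 z2 z3 where "x1 = vary * z1" "x2 = vary * z2" "x3 = vary * z3"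
    by (elim exE)
  then have z: "x' = scale3 vary (z1, z2, z3)"
    by (simp add: xy scale3_def)
  have "scale3 vary (scale3 varz (z1, z2, z3)) = scale3 vary y'"
    using * unfolding z by (simp add: mult.commute)
  then have "scale3 varz (z1, z2, z3) = y'"
    by (subst (asm) scale3_cancel_left) (auto simp: vary_def)
  \<comment> \<open>Closure of \<open>A\<close> under division by z puts the quotient into
    \<open>A\<close> and not just into S^3.\<close>
  with y' A(2) have "(z1, z2, z3) \<in> A" by blast
  moreover have "x = scale3 vary (z1, z2, z3) + scale3 a2 v + scale3 b2 w"
    using z by (simp add: x'_def algebra_simps)
  ultimately show ?thesis by blast
qed

text \<open>The assumption \<open>indep\<close> is linear independence over the complex numbers
  modulo (y, z) \<open>A\<close> and \<open>v\<close>, \<open>w\<close>. It is lifted first to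
  polynomials in z, then to polynomials in y and z.\<close>

context
  fixes J :: "'j set" and \<rho> :: "'j \<Rightarrow> S \<times> S \<times> S"
  assumes \<rho>: "\<And>j. j \<in> J \<Longrightarrow> \<rho> j \<in> A"
    and indep: "\<And>c y z a b. y \<in> A \<Longrightarrow> z \<in> A \<Longrightarrow>
      (\<Sum>j\<in>J. scale3 (const3 (c j)) (\<rho> j)) =
        scale3 vary y + scale3 varz z + scale3 a v + scale3 b w \<Longrightarrow> \<forall>j\<in>J. c j = 0"
begin

lemma sum_mem: "(\<Sum>j\<in>J. scale3 (r j) (\<rho> j)) \<in> A"
  by (intro S3.subspace_sum S3.subspace_scale A(1) \<rho>)

text \<open>The terms divisible by z form an element of z \<open>A\<close>, so only the constant
  terms survive in \<open>indep\<close>.\<close>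

lemma constant_coeffs:
  assumes y: "y \<in> A"
    and eq: "(\<Sum>j\<in>J. scale3 [:[:s j:]:] (\<rho> j)) = scale3 vary y + scale3 a v + scale3 b w"
  shows "\<forall>j\<in>J. coeff (s j) 0 = 0"
proof -
  define z where "z = (\<Sum>j\<in>J. scale3 [:[:poly_shift 1 (s j):]:] (\<rho> j))"
  have z: "z \<in> A" unfolding z_def by (rule sum_mem)
  have split: "[:[:s j:]:] = const3 (coeff (s j) 0) + varz * [:[:poly_shift 1 (s j):]:]" for j
    by (auto simp: const3_def varz_def poly_eq_iff coeff_pCons coeff_poly_shift split: nat.split)
  have "(\<Sum>j\<in>J. scale3 (const3 (coeff (s j) 0)) (\<rho> j)) + scale3 varz z =
      scale3 vary y + scale3 a v + scale3 b w"
    unfolding eq[symmetric] z_def split S3.scale_sum_right S3.scale_left_distrib sum.distrib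
      S3.scale_scale ..
  then have "(\<Sum>j\<in>J. scale3 (const3 (coeff (s j) 0)) (\<rho> j)) =
      scale3 vary y + scale3 varz (- z) + scale3 a v + scale3 b w"
    by (simp add: algebra_simps)
  then show ?thesis
    by (rule indep[OF y S3.subspace_neg[OF A(1) z]])
qed

text \<open>Once the constant terms vanish, the relation is divisible by z, and regularity of z
  gives a relation among the shifted coefficients. Iteration reaches every coefficient.\<close>

lemma independent_over_varz:
  assumes "y \<in> A"
    and "(\<Sum>j\<in>J. scale3 [:[:s j:]:] (\<rho> j)) = scale3 vary y + scale3 a v + scale3 b w"
  shows "\<forall>j\<in>J. s j = 0"
proof -
  have "\<forall>j\<in>J. coeff (s j) n = 0" for n
    using assms
  proof (induction n arbitrary: s y a b)
    case (Suc n s y a b)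
    have s0: "\<forall>j\<in>J. coeff (s j) 0 = 0"
      using Suc.prems by (rule constant_coeffs)
    have "[:[:s j:]:] = varz * [:[:poly_shift 1 (s j):]:]" if "j \<in> J" for j
      using s0 that
      by (auto simp: varz_def poly_eq_iff coeff_pCons coeff_poly_shift split: nat.split)
    note shift = this
    have "scale3 varz (\<Sum>j\<in>J. scale3 [:[:poly_shift 1 (s j):]:] (\<rho> j)) =
        (\<Sum>j\<in>J. scale3 [:[:s j:]:] (\<rho> j))"
      unfolding S3.scale_sum_right S3.scale_scale by (rule sum.cong[OF refl]) (simp only: shift)
    with Suc.prems(2) have "scale3 varz (\<Sum>j\<in>J. scale3 [:[:poly_shift 1 (s j):]:] (\<rho> j)) =
        scale3 vary y + scale3 a v + scale3 b w"
      by (rule trans[rotated])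
    from varz_regular[OF Suc.prems(1) this] obtain y' a' b' where "y' \<in> A"
      "(\<Sum>j\<in>J. scale3 [:[:poly_shift 1 (s j):]:] (\<rho> j)) = scale3 vary y' + scale3 a' v + scale3 b' w"
      by blast
    from Suc.IH[OF this] show ?case
      by (simp add: coeff_poly_shift)
  qed (rule constant_coeffs)
  then show ?thesis
    by (simp add: poly_eq_iff)
qed

text \<open>The same descent with y: the part free of y is settled by independence over the
  polynomials in z, and regularity of y divides the rest by y.\<close>

lemma independent_over_vary_varz:
  assumes "(\<Sum>j\<in>J. scale3 [:r j:] (\<rho> j)) = scale3 a v + scale3 b w"
  shows "\<forall>j\<in>J. r j = 0"
proof -
  have coeff0: "\<forall>j\<in>J. coeff (r j) 0 = 0"
    if eq: "(\<Sum>j\<in>J. scale3 [:r j:] (\<rho> j)) = scale3 a v + scale3 b w" for r a b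
  proof -
    define y where "y = (\<Sum>j\<in>J. scale3 [:poly_shift 1 (r j):] (\<rho> j))"
    have y: "y \<in> A" unfolding y_def by (rule sum_mem)
    have split: "[:r j:] = [:[:coeff (r j) 0:]:] + vary * [:poly_shift 1 (r j):]" for j
      by (auto simp: vary_def poly_eq_iff coeff_pCons coeff_poly_shift split: nat.split)
    have "(\<Sum>j\<in>J. scale3 [:[:coeff (r j) 0:]:] (\<rho> j)) + scale3 vary y = scale3 a v + scale3 b w"
      unfolding eq[symmetric] y_def split S3.scale_sum_right S3.scale_left_distrib sum.distrib
        S3.scale_scale ..
    then have "(\<Sum>j\<in>J. scale3 [:[:coeff (r j) 0:]:] (\<rho> j)) =
        scale3 vary (- y) + scale3 a v + scale3 b w"
      by (simp add: algebra_simps)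
    then show ?thesis
      by (rule independent_over_varz[OF S3.subspace_neg[OF A(1) y]])
  qed
  have "\<forall>j\<in>J. coeff (r j) n = 0" for n
    using assms
  proof (induction n arbitrary: r a b)
    case (Suc n r a b)
    have r0: "\<forall>j\<in>J. coeff (r j) 0 = 0"
      using Suc.prems by (rule coeff0)
    have "[:r j:] = vary * [:poly_shift 1 (r j):]" if "j \<in> J" for j
      using r0 that
      by (auto simp: vary_def poly_eq_iff coeff_pCons coeff_poly_shift split: nat.split)
    note shift = this
    have "scale3 vary (\<Sum>j\<in>J. scale3 [:poly_shift 1 (r j):] (\<rho> j)) =
        (\<Sum>j\<in>J. scale3 [:r j:] (\<rho> j))"
      unfolding S3.scale_sum_right S3.scale_scale by (rule sum.cong[OF refl]) (simp only: shift)
    with Suc.prems have "scale3 vary (\<Sum>j\<in>J. scale3 [:poly_shift 1 (r j):] (\<rho> j)) =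
        scale3 a v + scale3 b w"
      by (rule trans[rotated])
    from vary_regular[OF this] obtain a' b' where
      "(\<Sum>j\<in>J. scale3 [:poly_shift 1 (r j):] (\<rho> j)) = scale3 a' v + scale3 b' w"
      by blast
    from Suc.IH[OF this] show ?case
      by (simp add: coeff_poly_shift)
  qed (rule coeff0)
  then show ?thesis
    by (simp add: poly_eq_iff)
qed

end
end

section \<open>Homogeneous components and the gradient\<close>

lemma S_eqI: "(\<And>i j k. coeff3 p i j k = coeff3 q i j k) \<Longrightarrow> p = q"
  by (simp add: poly_eq_iff coeff3_def)

lemma coeff3_simps:
  "coeff3 0 i j k = 0" "coeff3 (p + q) i j k = coeff3 p i j k + coeff3 q i j k"
  "coeff3 (p - q) i j k = coeff3 p i j k - coeff3 q i j k"
  "coeff3 (- p) i j k = - coeff3 p i j k"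
  "coeff3 (const3 c) i j k = (if i = 0 \<and> j = 0 \<and> k = 0 then c else 0)"
  "coeff3 (const3 c * p) i j k = c * coeff3 p i j k"
  "coeff3 (varx * p) i j k = (case i of 0 \<Rightarrow> 0 | Suc i \<Rightarrow> coeff3 p i j k)"
  "coeff3 (vary * p) i j k = (case j of 0 \<Rightarrow> 0 | Suc j \<Rightarrow> coeff3 p i j k)"
  "coeff3 (varz * p) i j k = (case k of 0 \<Rightarrow> 0 | Suc k \<Rightarrow> coeff3 p i j k)"
  by (auto simp: coeff3_def const3_def varx_def vary_def varz_def coeff_pCons split: nat.split)

text \<open>The substitution \<open>p \<mapsto> p (T x, T y, T z)\<close>; its coefficient at \<open>T ^ n\<close> is the homogeneous
  component of degree \<open>n\<close>.\<close>

definition graded :: "S \<Rightarrow> S poly"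
  where "graded = eval3 (\<lambda>c. [:const3 c:]) [:0, varx:] [:0, vary:] [:0, varz:]"

lemma ring_map_const_graded: "ring_map (\<lambda>c. [:const3 c:])"
  by unfold_locales (auto simp: const3_def pCons_one)

interpretation graded: ring_map graded
  unfolding graded_def by (intro ring_map_eval3 ring_map_const_graded)

lemma graded_simps:
  "graded (const3 c) = [:const3 c:]" "graded varx = [:0, varx:]"
  "graded vary = [:0, vary:]" "graded varz = [:0, varz:]"
  by (simp_all add: graded_def eval3_simps ring_map_const_graded)

lemma coeff3_graded: "coeff3 (coeff (graded p) n) i j k = (if i + j + k = n then coeff3 p i j k else 0)"
proof (induction p arbitrary: n i j k rule: S_induct)
  case (const3 c)
  then show ?case
    by (auto simp: graded_simps coeff_pCons coeff3_simps split: nat.split)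
next
  case (add p q)
  then show ?case
    by (simp add: graded.add coeff3_simps)
qed (auto simp: graded.mult graded_simps coeff_pCons coeff3_simps split: nat.split)

text \<open>Homogeneity becomes an equation in S[T], where products and differences follow from
  \<open>graded\<close> being a ring homomorphism.\<close>

lemma homogeneous_iff_graded: "homogeneous n p \<longleftrightarrow> graded p = monom p n"
proof
  assume "homogeneous n p"
  then have "coeff (graded p) k = coeff (monom p n) k" for k
    by (intro S_eqI) (auto simp: coeff3_graded homogeneous_def coeff3_simps)
  then show "graded p = monom p n" by (simp add: poly_eq_iff)
next
  assume *: "graded p = monom p n"
  show "homogeneous n p"
    unfolding homogeneous_def
  proof (intro allI impI)
    fix i j k assume "coeff3 p i j k \<noteq> 0"
    then have "coeff3 (coeff (graded p) (i + j + k)) i j k \<noteq> 0"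
      by (simp add: coeff3_graded)
    then show "i + j + k = n"
      unfolding * by (auto simp: coeff3_simps split: if_splits)
  qed
qed

lemma homogeneous_0: "homogeneous n 0"
  by (simp add: homogeneous_def coeff3_simps)

lemma homogeneous_diff: "homogeneous n p \<Longrightarrow> homogeneous n q \<Longrightarrow> homogeneous n (p - q)"
  by (simp add: homogeneous_iff_graded graded.diff diff_monom)

lemma homogeneous_mult: "homogeneous m p \<Longrightarrow> homogeneous n q \<Longrightarrow> homogeneous (m + n) (p * q)"
  by (simp add: homogeneous_iff_graded graded.mult mult_monom)

lemma coeff_graded_0: "coeff (graded p) 0 = const3 (coeff3 p 0 0 0)"
  by (rule S_eqI) (auto simp: coeff3_graded coeff3_simps)

lemma graded_eq_0_iff: "graded p = 0 \<longleftrightarrow> p = 0"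
proof
  assume "graded p = 0"
  then have "coeff3 p i j k = 0" for i j k
    using coeff3_graded[of p "i + j + k" i j k] by (simp add: coeff3_simps)
  then show "p = 0" by (intro S_eqI) (simp add: coeff3_simps)
qed (simp add: graded.zero)

text \<open>Comparing powers of T in \<open>graded p * monom q m = monom (p * q) n\<close> leaves a
  single power in \<open>graded p\<close>.\<close>

lemma homogeneous_cofactor:
  assumes "homogeneous n (p * q)" "homogeneous m q" "p \<noteq> 0" "q \<noteq> 0"
  shows "\<exists>k. homogeneous k p \<and> k + m = n"
proof -
  have *: "graded p * monom q m = monom (p * q) n"
    using assms by (simp add: homogeneous_iff_graded graded.mult)
  have "graded p \<noteq> 0"
    using assms(3) by (simp add: graded_eq_0_iff)
  then have "degree (graded p) + m = n"
    using arg_cong[OF *, of degree] assms(3,4) by (simp add: degree_mult_eq degree_monom_eq)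
  moreover have "coeff (graded p) i = (if i + m = n then p else 0)" for i
    using arg_cong[OF *, of "\<lambda>r. coeff r (i + m)"] assms(4)
    by (auto simp: coeff_monom_mult mult.commute[of _ "monom q m"] split: if_splits)
  ultimately have "graded p = monom p (degree (graded p))"
    by (auto simp: poly_eq_iff)
  with \<open>degree (graded p) + m = n\<close> show ?thesis
    by (auto simp: homogeneous_iff_graded)
qed

lemma is_unit_if_degree_graded_0:
  assumes "degree (graded p) = 0" "p \<noteq> 0"
  shows "is_unit p"
proof -
  have "p = const3 (coeff3 p 0 0 0)"
  proof (rule S_eqI)
    fix i j k
    have "coeff (graded p) (i + j + k) = 0" if "i + j + k \<noteq> 0"
      using that assms by (intro coeff_eq_0) auto
    then show "coeff3 p i j k = coeff3 (const3 (coeff3 p 0 0 0)) i j k"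
      using coeff3_graded[of p "i + j + k" i j k] by (auto simp: coeff3_simps)
  qed
  then obtain c where "p = const3 c" by blast
  with assms(2) show ?thesis
    by (auto simp: const3_def is_unit_const_poly_iff dvd_field_iff)
qed

section \<open>Partial derivatives and primitivity of the gradient\<close>

lemma homogeneous_dx: "homogeneous d f \<Longrightarrow> homogeneous (d - 1) (dx f)"
  by (force simp: homogeneous_def coeff3_dx)

lemma homogeneous_dy: "homogeneous d f \<Longrightarrow> homogeneous (d - 1) (dy f)"
  by (force simp: homogeneous_def coeff3_dy)

lemma homogeneous_dz: "homogeneous d f \<Longrightarrow> homogeneous (d - 1) (dz f)"
  by (force simp: homogeneous_def coeff3_dz)

lemma Euler_identity:
  assumes "homogeneous d f"
  shows "varx * dx f + vary * dy f + varz * dz f = const3 (of_nat d) * f"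
proof (rule S_eqI)
  fix i j k
  have "coeff3 (varx * dx f + vary * dy f + varz * dz f) i j k = of_nat (i + j + k) * coeff3 f i j k"
    by (auto simp: coeff3_simps coeff3_dx coeff3_dy coeff3_dz algebra_simps split: nat.split)
  also have "\<dots> = coeff3 (const3 (of_nat d) * f) i j k"
    using assms by (cases "coeff3 f i j k = 0") (auto simp: coeff3_simps homogeneous_def)
  finally show "coeff3 (varx * dx f + vary * dy f + varz * dz f) i j k =
      coeff3 (const3 (of_nat d) * f) i j k" .
qed

text \<open>A nonzero derivative has smaller degree than \<open>p\<close>, so it cannot be a
  multiple of \<open>p\<close>; in characteristic 0 a zero derivative means a constant.\<close>

lemma pderiv_eq_0_if_dvd:
  fixes p :: "'a::{idom,ring_char_0} poly"
  assumes "p dvd pderiv p"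
  shows "\<exists>c. p = [:c:]"
proof (cases "pderiv p = 0")
  case True
  then show ?thesis
    by (metis pderiv_eq_0_iff degree_eq_zeroE)
next
  case False
  then have "degree p \<le> degree (pderiv p)" "degree p \<noteq> 0"
    using assms by (auto simp: dvd_imp_degree_le pderiv_eq_0_iff)
  then show ?thesis by (simp add: degree_pderiv)
qed

lemma dvd_partials_imp_const:
  assumes "g dvd dx g" "g dvd dy g" "g dvd dz g"
  shows "\<exists>c. g = const3 c"
proof -
  obtain g1 where g1: "g = [:g1:]"
    using pderiv_eq_0_if_dvd assms(1) by (auto simp: dx_def)
  then have "g1 dvd pderiv g1"
    using assms(2) by (auto simp: dy_def map_poly_pCons)
  then obtain g2 where g2: "g1 = [:g2:]"
    using pderiv_eq_0_if_dvd by blast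
  then have "g2 dvd pderiv g2"
    using assms(3) by (auto simp: dz_def g1 map_poly_pCons)
  then obtain c where "g2 = [:c:]"
    using pderiv_eq_0_if_dvd by blast
  with g1 g2 show ?thesis by (auto simp: const3_def)
qed

text \<open>A derivation of the coefficient ring, applied coefficientwise, is again a derivation.
  This yields the product rule for \<open>dy\<close> and \<open>dz\<close>.\<close>

lemma map_poly_derivation:
  fixes \<delta> :: "'a::comm_ring_1 \<Rightarrow> 'a"
  assumes add: "\<And>a b. \<delta> (a + b) = \<delta> a + \<delta> b" and mult: "\<And>a b. \<delta> (a * b) = \<delta> a * b + a * \<delta> b"
  shows "map_poly \<delta> (p + q) = map_poly \<delta> p + map_poly \<delta> q"
    and "map_poly \<delta> (p * q) = map_poly \<delta> p * q + p * map_poly \<delta> q"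
proof -
  have zero: "\<delta> 0 = 0"
    using add[of 0 0] by simp
  have sum: "\<delta> (sum h I) = (\<Sum>i\<in>I. \<delta> (h i))" for h :: "nat \<Rightarrow> 'a" and I
    by (induction I rule: infinite_finite_induct) (auto simp: zero add)
  show "map_poly \<delta> (p + q) = map_poly \<delta> p + map_poly \<delta> q"
    by (simp add: poly_eq_iff coeff_map_poly zero add)
  show "map_poly \<delta> (p * q) = map_poly \<delta> p * q + p * map_poly \<delta> q"
    by (simp add: poly_eq_iff coeff_map_poly zero coeff_mult sum mult sum.distrib)
qed

lemma partials_mult:
  "dx (p * q) = dx p * q + p * dx q"
  "dy (p * q) = dy p * q + p * dy q"
  "dz (p * q) = dz p * q + p * dz q"
proof -
  show "dx (p * q) = dx p * q + p * dx q"
    by (simp add: dx_def pderiv_mult algebra_simps)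
  have 1: "pderiv (r * s) = pderiv r * s + r * pderiv s" for r s :: "'a::idom poly"
    by (simp add: pderiv_mult algebra_simps)
  show "dy (p * q) = dy p * q + p * dy q"
    unfolding dy_def by (intro map_poly_derivation pderiv_add 1)
  show "dz (p * q) = dz p * q + p * dz q"
    unfolding dz_def by (intro map_poly_derivation pderiv_add 1)
qed

definition primitive3 :: "S \<times> S \<times> S \<Rightarrow> bool"
  where "primitive3 = (\<lambda>(a, b, c). \<forall>t. t dvd a \<and> t dvd b \<and> t dvd c \<longrightarrow> is_unit t)"

definition grad :: "S \<Rightarrow> S \<times> S \<times> S"
  where "grad f = (dx f, dy f, dz f)"

text \<open>By Euler's identity a common divisor of the partials divides \<open>f\<close>. For a
  prime such divisor \<open>p\<close>, write f = p k with \<open>p\<close> not dividing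
  \<open>k\<close>; the product rule makes \<open>p\<close> divide its own partials, so
  \<open>p\<close> is constant.\<close>

lemma primitive3_grad:
  assumes "homogeneous d f" "0 < d" "squarefree f"
  shows "primitive3 (grad f)"
  unfolding primitive3_def grad_def split
proof (intro allI impI, elim conjE)
  fix t assume t: "t dvd dx f" "t dvd dy f" "t dvd dz f"
  have unit: "is_unit (const3 c)" if "c \<noteq> 0" for c
    using that by (auto simp: const3_def is_unit_const_poly_iff dvd_field_iff)
  have "f \<noteq> 0" using assms(3) by auto
  have dvd_f: "s dvd f" if "s dvd dx f" "s dvd dy f" "s dvd dz f" for s
  proof -
    have "s dvd const3 (of_nat d) * f"
      unfolding Euler_identity[OF assms(1), symmetric] using that by simp
    then show ?thesis
      using unit[of "of_nat d"] assms(2) by (simp add: dvd_mult_unit_iff')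
  qed
  show "is_unit t"
  proof (rule ccontr)
    assume "\<not> is_unit t"
    moreover have "t \<noteq> 0"
      using dvd_f[OF t] \<open>f \<noteq> 0\<close> by auto
    ultimately obtain p where p: "p dvd t" "prime p"
      using prime_divisor_exists by blast
    have pd: "p dvd dx f" "p dvd dy f" "p dvd dz f"
      using p(1) t dvd_trans by blast+
    then obtain k where k: "f = p * k"
      using dvd_f by (meson dvdE)
    have "\<not> p dvd k"
    proof
      assume "p dvd k"
      then have "p ^ 2 dvd f"
        unfolding k by (simp add: power2_eq_square mult_dvd_mono)
      with assms(3) have "is_unit p" by (rule squarefreeD)
      with p(2) show False by auto
    qed
    moreover have "p dvd dx p * k" "p dvd dy p * k" "p dvd dz p * k"
      using pd unfolding k partials_mult by (simp_all add: dvd_add_left_iff)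
    ultimately have "p dvd dx p" "p dvd dy p" "p dvd dz p"
      using p(2) by (simp_all add: prime_dvd_mult_iff)
    from dvd_partials_imp_const[OF this] obtain c where "p = const3 c"
      by blast
    with p(2) unit[of c] show False
      by (cases "c = 0") (auto simp: const3_def)
  qed
qed

section \<open>Primitive vectors and cross products\<close>

text \<open>Up to a unit, the gcd of a s, b s, c s is \<open>s\<close> times the gcd of a, b, c,
  that is, \<open>s\<close> itself.\<close>

lemma primitive3_dvd:
  assumes "primitive3 (a, b, c)" "t dvd a * s" "t dvd b * s" "t dvd c * s"
  shows "t dvd s"
proof -
  define g where "g = gcd a (gcd b c)"
  have "is_unit g"
  proof -
    have "g dvd a" "g dvd gcd b c"
      unfolding g_def by (rule gcd_dvd1, rule gcd_dvd2)
    moreover from this(2) have "g dvd b" "g dvd c"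
      by simp_all
    ultimately show ?thesis
      using assms(1) by (simp add: primitive3_def)
  qed
  have "t dvd gcd (b * s) (c * s)"
    using assms by simp
  then have "t dvd gcd b c * s"
    by (simp add: gcd_mult_right gcd.commute)
  with assms(2) have "t dvd gcd (a * s) (gcd b c * s)"
    by simp
  then have "t dvd g * s"
    by (simp add: gcd_mult_right gcd.commute g_def)
  with \<open>is_unit g\<close> show ?thesis
    by (simp add: dvd_mult_unit_iff')
qed

text \<open>The hypothesis says that the cross product of \<open>v\<close> and \<open>x\<close>
  vanishes. For a nonzero entry of \<open>v\<close>, say v1, it makes v1 divide x1 times every entry
  of \<open>v\<close>; by primitivity v1 divides x1, and the quotient is the multiplier.\<close>

lemma parallel_imp_multiple:
  assumes "primitive3 v" and det: "\<And>t. det3 t v x = 0"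
  shows "\<exists>a. x = scale3 a v"
proof -
  obtain v1 v2 v3 x1 x2 x3 where vx: "v = (v1, v2, v3)" "x = (x1, x2, x3)"
    by (metis prod_cases3)
  have eq: "v2 * x3 = v3 * x2" "v3 * x1 = v1 * x3" "v1 * x2 = v2 * x1"
    using det[of "(1, 0, 0)"] det[of "(0, 1, 0)"] det[of "(0, 0, 1)"]
    by (simp_all add: vx det3_def)
  have prim: "primitive3 (v1, v2, v3)"
    using assms(1) by (simp add: vx)
  then have "v1 \<noteq> 0 \<or> v2 \<noteq> 0 \<or> v3 \<noteq> 0"
    by (auto simp: primitive3_def dest: spec[of _ 0])
  then consider "v1 \<noteq> 0" | "v2 \<noteq> 0" | "v3 \<noteq> 0" by blast
  then show ?thesis
  proof cases
    case 1
    have "v1 dvd x1"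
      by (rule primitive3_dvd[OF prim]) (simp_all add: eq(2) eq(3)[symmetric])
    then obtain a where a: "x1 = v1 * a" by (elim dvdE)
    have "v1 * x2 = v1 * (a * v2)" "v1 * x3 = v1 * (a * v3)"
      using eq(3) eq(2) unfolding a by (simp_all only: mult_ac)
    with 1 have "x2 = a * v2" "x3 = a * v3"
      by simp_all
    then have "x = scale3 a v"
      by (simp add: vx scale3_def a mult.commute)
    then show ?thesis by blast
  next
    case 2
    have "v2 dvd x2"
      by (rule primitive3_dvd[OF prim]) (simp_all add: eq(3) eq(1)[symmetric])
    then obtain a where a: "x2 = v2 * a" by (elim dvdE)
    have "v2 * x1 = v2 * (a * v1)" "v2 * x3 = v2 * (a * v3)"
      using eq(3) eq(1) unfolding a by (simp_all only: mult_ac)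
    with 2 have "x1 = a * v1" "x3 = a * v3"
      by simp_all
    then have "x = scale3 a v"
      by (simp add: vx scale3_def a mult.commute)
    then show ?thesis by blast
  next
    case 3
    have "v3 dvd x3"
      by (rule primitive3_dvd[OF prim]) (simp_all add: eq(1) eq(2)[symmetric])
    then obtain a where a: "x3 = v3 * a" by (elim dvdE)
    have "v3 * x1 = v3 * (a * v1)" "v3 * x2 = v3 * (a * v2)"
      using eq(2) eq(1) unfolding a by (simp_all only: mult_ac)
    with 3 have "x1 = a * v1" "x2 = a * v2"
      by simp_all
    then have "x = scale3 a v"
      by (simp add: vx scale3_def a mult.commute)
    then show ?thesis by blast
  qed
qed

text \<open>Both syzygies are orthogonal to the gradient, so their cross product is parallel to it,
  hence a multiple because the gradient is primitive.\<close>

lemma det3_syzygies: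
  assumes "primitive3 (grad f)" "x \<in> AR f" "y \<in> AR f"
  shows "\<exists>u. \<forall>a b c. det3 (a, b, c) x y = u * (a * dx f + b * dy f + c * dz f)"
proof -
  define w where "w = (det3 (1, 0, 0) x y, det3 (0, 1, 0) x y, det3 (0, 0, 1) x y)"
  obtain x1 x2 x3 y1 y2 y3 where xy: "x = (x1, x2, x3)" "y = (y1, y2, y3)"
    by (metis prod_cases3)
  have 0: "x1 * dx f + x2 * dy f + x3 * dz f = 0" "y1 * dx f + y2 * dy f + y3 * dz f = 0"
    using assms(2,3) by (simp_all add: xy AR_def)
  \<comment> \<open>The expansion of the vector triple product of the gradient, \<open>x\<close> and
    \<open>y\<close>, paired with t.\<close>
  have "det3 (t1, t2, t3) (grad f) w =
      (y1 * dx f + y2 * dy f + y3 * dz f) * (t1 * x1 + t2 * x2 + t3 * x3) -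
      (x1 * dx f + x2 * dy f + x3 * dz f) * (t1 * y1 + t2 * y2 + t3 * y3)" for t1 t2 t3
    by (simp add: w_def det3_def xy grad_def algebra_simps)
  then have "det3 t (grad f) w = 0" for t
    by (cases t) (simp add: 0)
  from parallel_imp_multiple[OF assms(1) this] obtain u where "w = scale3 u (grad f)" ..
  then have u: "det3 (1, 0, 0) x y = u * dx f" "det3 (0, 1, 0) x y = u * dy f"
    "det3 (0, 0, 1) x y = u * dz f"
    by (simp_all add: w_def scale3_def grad_def)
  have "det3 (a, b, c) x y = a * det3 (1, 0, 0) x y + b * det3 (0, 1, 0) x y + c * det3 (0, 0, 1) x y"
    for a b c
    by (simp add: det3_def xy)
  then have "det3 (a, b, c) x y = u * (a * dx f + b * dy f + c * dz f)" for a b c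
    unfolding u by (simp add: algebra_simps)
  then show ?thesis by blast
qed

section \<open>Minimal generators of the module of Jacobian syzygies\<close>

definition component3 :: "nat \<Rightarrow> S \<times> S \<times> S \<Rightarrow> S \<times> S \<times> S"
  where "component3 n = map3 (\<lambda>p. coeff (graded p) n)"

lemma component3_sum: "component3 n (\<Sum>i\<in>I. x i) = (\<Sum>i\<in>I. component3 n (x i))"
proof -
  have 1: "component3 n (v + w) = component3 n v + component3 n w" for v w
    by (cases v; cases w) (simp add: component3_def map3_def graded.add)
  have 2: "component3 n 0 = 0"
    by (simp add: component3_def map3_def graded.zero zero_prod_def)
  show ?thesis
    by (induction I rule: infinite_finite_induct) (simp_all add: 1 2)
qed

text \<open>Only the component of \<open>s\<close> of degree n - k contributes. The guard is
  essential, since subtraction is truncated for k > n.\<close>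

lemma component3_scale3:
  assumes "homogeneous3 k v"
  shows "component3 n (scale3 s v) = scale3 (if k \<le> n then coeff (graded s) (n - k) else 0) v"
  using assms
  by (cases v) (auto simp: component3_def map3_def scale3_def homogeneous3_def
      homogeneous_iff_graded graded.mult coeff_monom_mult mult.commute[of "graded s"])

lemma component3_homogeneous: "homogeneous3 n v \<Longrightarrow> component3 n v = v"
  by (cases v) (simp add: component3_def map3_def homogeneous3_def homogeneous_iff_graded)

text \<open>Each partial occurs in two of the Koszul syzygies. If it were nonzero, both multipliers
  of \<open>v\<close> would be nonzero, but one of the two syzygies has entry 0 where the other has
  that partial. So all partials would vanish, against primitivity.\<close>

lemma Koszul_not_cyclic:
  assumes "homogeneous d f" "primitive3 (grad f)"
  shows "\<exists>x\<in>AR f. homogeneous3 (d - 1) x \<and> (\<forall>a. x \<noteq> scale3 a v)"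
proof (rule ccontr)
  assume *: "\<not> ?thesis"
  note hom = homogeneous_dx[OF assms(1)] homogeneous_dy[OF assms(1)] homogeneous_dz[OF assms(1)]
    homogeneous_diff[OF homogeneous_0] homogeneous_0
  have neg: "homogeneous n p \<Longrightarrow> homogeneous n (- p)" for n p
    using homogeneous_diff[OF homogeneous_0, of n p] by simp
  have "(dy f, - dx f, 0) \<in> AR f" "(dz f, 0, - dx f) \<in> AR f" "(0, dz f, - dy f) \<in> AR f"
    by (simp_all add: AR_def mult.commute)
  moreover have "homogeneous3 (d - 1) (dy f, - dx f, 0)" "homogeneous3 (d - 1) (dz f, 0, - dx f)"
    "homogeneous3 (d - 1) (0, dz f, - dy f)"
    by (simp_all add: homogeneous3_def hom neg del: One_nat_def)
  ultimately obtain a b c where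
    abc: "(dy f, - dx f, 0) = scale3 a v" "(dz f, 0, - dx f) = scale3 b v" "(0, dz f, - dy f) = scale3 c v"
    using * by meson
  obtain v1 v2 v3 where v: "v = (v1, v2, v3)" by (metis prod_cases3)
  have "dx f = 0 \<and> dy f = 0 \<and> dz f = 0"
    using abc unfolding v scale3_def by auto
  then show False
    using assms(2) by (auto simp: primitive3_def grad_def dest: spec[of _ 0])
qed

section \<open>Consequences of minimality\<close>

locale syzygy_generators =
  fixes f :: S and d m :: nat and e :: "nat \<Rightarrow> nat" and \<rho> :: "nat \<Rightarrow> S \<times> S \<times> S"
  assumes d_pos: "0 < d" and f: "homogeneous d f" "squarefree f"
    and inj: "inj_on \<rho> {1..m}"
    and hom: "\<And>j. j \<in> {1..m} \<Longrightarrow> homogeneous3 (e j) (\<rho> j)"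
    and span: "S3.span (\<rho> ` {1..m}) = AR f"
    and minimal: "\<And>H. H \<subset> \<rho> ` {1..m} \<Longrightarrow> S3.span H \<noteq> AR f"
    and mono: "mono_on {1..m} e"
begin

lemma primitive_grad: "primitive3 (grad f)"
  using f(1) d_pos f(2) by (rule primitive3_grad)

lemma gen_in_AR: "j \<in> {1..m} \<Longrightarrow> \<rho> j \<in> AR f"
  unfolding span[symmetric] by (intro S3.span_base) simp

lemma AR_E:
  assumes "x \<in> AR f"
  obtains s where "x = (\<Sum>j = 1..m. scale3 (s j) (\<rho> j))"
proof -
  have "x \<in> range (\<lambda>u. \<Sum>v\<in>\<rho> ` {1..m}. scale3 (u v) v)"
    using assms by (simp add: span[symmetric] S3.span_finite)
  then obtain u where "x = (\<Sum>v\<in>\<rho> ` {1..m}. scale3 (u v) v)" by blast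
  also have "\<dots> = (\<Sum>j = 1..m. scale3 (u (\<rho> j)) (\<rho> j))"
    using sum.reindex[OF inj] by (simp del: One_nat_def)
  finally show thesis by (rule that)
qed

lemma gen_not_redundant:
  assumes "k \<in> {1..m}"
  shows "\<rho> k \<noteq> (\<Sum>j\<in>{1..m} - {k}. scale3 (s j) (\<rho> j))"
proof
  let ?H = "\<rho> ` ({1..m} - {k})"
  assume eq: "\<rho> k = (\<Sum>j\<in>{1..m} - {k}. scale3 (s j) (\<rho> j))"
  have "\<rho> k \<in> S3.span ?H"
    unfolding eq by (intro S3.span_sum S3.span_scale S3.span_base) auto
  then have "insert (\<rho> k) ?H \<subseteq> S3.span ?H"
    using S3.span_superset[of ?H] by simp
  moreover have "\<rho> ` {1..m} \<subseteq> insert (\<rho> k) ?H"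
    by blast
  ultimately have "\<rho> ` {1..m} \<subseteq> S3.span ?H"
    by (rule subset_trans[rotated])
  from S3.span_minimal[OF this S3.subspace_span] have "AR f \<subseteq> S3.span ?H"
    unfolding span .
  moreover have "S3.span ?H \<subseteq> AR f"
    unfolding span[symmetric] by (rule S3.span_mono[OF image_mono[OF Diff_subset]])
  ultimately have "S3.span ?H = AR f"
    by (rule subset_antisym[rotated])
  \<comment> \<open>Injectivity of \<open>\<rho>\<close> ensures that dropping the index
    \<open>k\<close> really drops a generator.\<close>
  moreover have "\<rho> k \<notin> ?H"
    using inj_on_image_mem_iff[OF inj assms Diff_subset] by simp
  then have "?H \<subset> \<rho> ` {1..m}"
    using assms by (intro psubsetI image_mono) auto
  ultimately show False
    using minimal[of ?H] by metis
qed

text \<open>Graded Nakayama: in the component of degree \<open>e k\<close> the coefficient of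
  \<open>\<rho> k\<close> is the constant term of \<open>p k\<close>. Were it nonzero, the relation
  could be solved for \<open>\<rho> k\<close>, contradicting minimality.\<close>

lemma constant_coeff_relation:
  assumes rel: "(\<Sum>j = 1..m. scale3 (p j) (\<rho> j)) = 0" and k: "k \<in> {1..m}"
  shows "coeff3 (p k) 0 0 0 = 0"
proof (rule ccontr)
  define c where "c = coeff3 (p k) 0 0 0"
  assume "coeff3 (p k) 0 0 0 \<noteq> 0"
  then have c: "c \<noteq> 0" by (simp add: c_def)
  define q where "q j = (if e j \<le> e k then coeff (graded (p j)) (e k - e j) else 0)" for j
  have "0 = component3 (e k) (\<Sum>j = 1..m. scale3 (p j) (\<rho> j))"
    unfolding rel by (simp add: component3_def map3_def graded.zero zero_prod_def)
  also have "\<dots> = (\<Sum>j = 1..m. scale3 (q j) (\<rho> j))"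
    unfolding component3_sum q_def by (intro sum.cong component3_scale3 hom refl)
  also have "\<dots> = scale3 (q k) (\<rho> k) + (\<Sum>j\<in>{1..m} - {k}. scale3 (q j) (\<rho> j))"
    using k by (simp add: sum.remove)
  finally have "scale3 (const3 c) (\<rho> k) = - (\<Sum>j\<in>{1..m} - {k}. scale3 (q j) (\<rho> j))"
    by (simp add: q_def coeff_graded_0 c_def eq_neg_iff_add_eq_0)
  then have "scale3 (const3 (1 / c)) (scale3 (const3 c) (\<rho> k)) =
      - scale3 (const3 (1 / c)) (\<Sum>j\<in>{1..m} - {k}. scale3 (q j) (\<rho> j))"
    by simp
  moreover have "const3 (1 / c) * const3 c = 1"
    using c by (simp add: const3_def pCons_one)
  ultimately have "\<rho> k = (\<Sum>j\<in>{1..m} - {k}. scale3 (- (const3 (1 / c) * q j)) (\<rho> j))"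
    by (simp add: S3.scale_sum_right sum_negf)
  then show False by (rule notE[OF gen_not_redundant[OF k]])
qed

text \<open>Expanding \<open>y\<close> and \<open>z\<close> in the generators gives a relation whose
  coefficient at \<open>\<rho> k\<close> has constant term \<open>c k\<close>, as \<open>l\<close>
  and \<open>l'\<close> have none. In the application \<open>l\<close> and \<open>l'\<close> are the
  images of y and z under the inverse shear.\<close>

lemma generators_independent_modulo:
  assumes "2 \<le> m" and y: "y \<in> AR f" and z: "z \<in> AR f"
    and l: "coeff3 l 0 0 0 = 0" "coeff3 l' 0 0 0 = 0"
    and eq: "(\<Sum>j = 3..m. scale3 (const3 (c j)) (\<rho> j)) =
      scale3 l y + scale3 l' z + scale3 a (\<rho> 1) + scale3 b (\<rho> 2)"
  shows "\<forall>j\<in>{3..m}. c j = 0"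
proof
  fix k assume k: "k \<in> {3..m}"
  obtain s where s: "y = (\<Sum>j = 1..m. scale3 (s j) (\<rho> j))" using y by (rule AR_E)
  obtain t where t: "z = (\<Sum>j = 1..m. scale3 (t j) (\<rho> j))" using z by (rule AR_E)
  define r where "r j = (if j = 1 then - a else if j = 2 then - b else const3 (c j))" for j :: nat
  define p where "p j = r j - l * s j - l' * t j" for j
  have "{1..m} = insert 1 (insert 2 {3..m})"
    using \<open>2 \<le> m\<close> by auto
  then have "(\<Sum>j = 1..m. scale3 (r j) (\<rho> j)) =
      scale3 (- a) (\<rho> 1) + (scale3 (- b) (\<rho> 2) + (\<Sum>j = 3..m. scale3 (const3 (c j)) (\<rho> j)))"
    by (simp add: r_def)
  then have "(\<Sum>j = 1..m. scale3 (r j) (\<rho> j)) = scale3 l y + scale3 l' z"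
    unfolding eq by simp
  then have "(\<Sum>j = 1..m. scale3 (p j) (\<rho> j)) = 0"
    unfolding s t p_def
    by (simp add: S3.scale_left_diff_distrib sum_subtractf S3.scale_sum_right)
  moreover have "k \<in> {1..m}" using k by auto
  ultimately have "coeff3 (p k) 0 0 0 = 0"
    by (rule constant_coeff_relation)
  moreover have "coeff3 (l * u) 0 0 0 = 0" "coeff3 (l' * u) 0 0 0 = 0" for u
    using l by (simp_all add: coeff3_def coeff_mult_0)
  ultimately show "c k = 0"
    using k by (simp add: p_def r_def coeff3_simps)
qed

text \<open>Otherwise every generator after the first has degree above d - 1, so all syzygies
  homogeneous of degree d - 1 are multiples of \<open>\<rho> 1\<close>, which the Koszul syzygies
  exclude.\<close>

lemma two_generators: "2 \<le> m \<and> e 2 \<le> d - 1"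
proof (rule ccontr)
  assume *: "\<not> ?thesis"
  have "\<exists>a. x = scale3 a (\<rho> 1)" if x: "x \<in> AR f" "homogeneous3 (d - 1) x" for x
  proof -
    obtain s where s: "x = (\<Sum>j = 1..m. scale3 (s j) (\<rho> j))" using x(1) by (rule AR_E)
    define q where "q j = (if e j \<le> d - 1 then coeff (graded (s j)) (d - 1 - e j) else 0)" for j
    have "x = component3 (d - 1) x"
      using x(2) by (simp add: component3_homogeneous)
    also have "\<dots> = (\<Sum>j = 1..m. scale3 (q j) (\<rho> j))"
      unfolding s component3_sum q_def by (intro sum.cong component3_scale3 hom refl)
    also have "\<dots> = (\<Sum>j\<in>{1..m} \<inter> {1}. scale3 (q j) (\<rho> j))"
    proof (intro sum.mono_neutral_right ballI)
      fix j assume j: "j \<in> {1..m} - {1..m} \<inter> {1}"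
      then have "e 2 \<le> e j"
        by (intro mono_onD[OF mono]) auto
      with * j have "q j = 0"
        by (auto simp: q_def)
      then show "scale3 (q j) (\<rho> j) = 0" by simp
    qed auto
    also have "\<dots> = scale3 (if m = 0 then 0 else q 1) (\<rho> 1)"
      by (cases "m = 0") (auto simp: Int_absorb1)
    finally show ?thesis by blast
  qed
  with Koszul_not_cyclic[OF f(1) primitive_grad, of "\<rho> 1"] show False by blast
qed

lemma e1_le_e2: "e 1 \<le> e 2"
  using two_generators by (intro mono_onD[OF mono]) auto

text \<open>Dividing \<open>\<rho> 1\<close> by a common factor gives another syzygy, which has no
  components below degree \<open>e 1\<close>, the least degree of a generator. Hence the factor has
  degree 0.\<close>

lemma primitive_gen1: "primitive3 (\<rho> 1)"
proof -
  have m: "1 \<in> {1..m}" using two_generators by auto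
  obtain a b c where abc: "\<rho> 1 = (a, b, c)" by (metis prod_cases3)
  have "\<rho> 1 \<noteq> 0"
    using gen_not_redundant[OF m, of "\<lambda>_. 0"] by simp
  have unit: "is_unit t" if t: "t * p \<noteq> 0" "homogeneous (e 1) (t * p)"
    and low: "\<And>n. n < e 1 \<Longrightarrow> coeff (graded p) n = 0" for t p
  proof (rule is_unit_if_degree_graded_0)
    have eq: "graded t * graded p = monom (t * p) (e 1)"
      using t(2) by (simp add: homogeneous_iff_graded graded.mult)
    have "graded p \<noteq> 0" "graded t \<noteq> 0"
      using t by (auto simp: graded_eq_0_iff)
    then have "degree (graded t) + degree (graded p) = e 1"
      using arg_cong[OF eq, of degree] t(1) by (simp add: degree_mult_eq degree_monom_eq)
    moreover have "e 1 \<le> degree (graded p)"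
      using low[of "degree (graded p)"] \<open>graded p \<noteq> 0\<close> by (meson leI leading_coeff_0_iff)
    ultimately show "degree (graded t) = 0" by simp
  qed (use t in auto)
  show ?thesis
    unfolding primitive3_def abc split
  proof (intro allI impI, elim conjE dvdE)
    fix t p q r assume t: "a = t * p" "b = t * q" "c = t * r"
    have "t \<noteq> 0"
      using \<open>\<rho> 1 \<noteq> 0\<close> unfolding abc t by (auto simp: zero_prod_def)
    have "(t * p, t * q, t * r) \<in> AR f"
      using gen_in_AR[OF m] unfolding abc t .
    then have "t * (p * dx f + q * dy f + r * dz f) = 0"
      by (simp add: AR_def algebra_simps)
    with \<open>t \<noteq> 0\<close> have "(p, q, r) \<in> AR f"
      by (simp add: AR_def)
    then obtain s where s: "(p, q, r) = (\<Sum>j = 1..m. scale3 (s j) (\<rho> j))" by (rule AR_E)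
    have "component3 n (p, q, r) = 0" if "n < e 1" for n
      unfolding s component3_sum
    proof (intro sum.neutral ballI)
      fix j assume j: "j \<in> {1..m}"
      then have "e 1 \<le> e j"
        by (intro mono_onD[OF mono]) auto
      with that show "component3 n (scale3 (s j) (\<rho> j)) = 0"
        by (simp add: component3_scale3[OF hom[OF j]])
    qed
    then have low: "n < e 1 \<Longrightarrow> coeff (graded p) n = 0" "n < e 1 \<Longrightarrow> coeff (graded q) n = 0"
      "n < e 1 \<Longrightarrow> coeff (graded r) n = 0" for n
      by (auto simp: component3_def map3_def zero_prod_def)
    have hom: "homogeneous (e 1) (t * p)" "homogeneous (e 1) (t * q)" "homogeneous (e 1) (t * r)"
      using hom[OF m] unfolding abc t homogeneous3_def by simp_all
    have "t * p \<noteq> 0 \<or> t * q \<noteq> 0 \<or> t * r \<noteq> 0"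
      using \<open>\<rho> 1 \<noteq> 0\<close> unfolding abc t by (auto simp: zero_prod_def)
    then show "is_unit t"
      by (elim disjE unit[OF _ hom(1) low(1)] unit[OF _ hom(2) low(2)] unit[OF _ hom(3) low(3)])
  qed
qed

text \<open>Otherwise \<open>\<rho> 2\<close> would be a multiple of the primitive vector
  \<open>\<rho> 1\<close>, hence redundant.\<close>

lemma det3_gens: "\<exists>t. det3 t (\<rho> 1) (\<rho> 2) \<noteq> 0"
proof (rule ccontr)
  assume "\<not> ?thesis"
  then obtain a where a: "\<rho> 2 = scale3 a (\<rho> 1)"
    using parallel_imp_multiple[OF primitive_gen1, of "\<rho> 2"] by auto
  have "(\<Sum>j\<in>{1..m} - {2}. scale3 (if j = 1 then a else 0) (\<rho> j)) =
      (\<Sum>j\<in>{1}. scale3 (if j = 1 then a else 0) (\<rho> j))"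
    using two_generators by (intro sum.mono_neutral_right) auto
  with a gen_not_redundant[of 2 "\<lambda>j. if j = 1 then a else 0"] two_generators show False
    by simp
qed

lemma number_of_generators_bound: "int m \<le> int (e 1) + int (e 2) - int d + 3"
proof -
  have m: "2 \<le> m" "1 \<in> {1..m}" "2 \<in> {1..m}"
    using two_generators by auto
  note gens = gen_in_AR[OF m(2)] gen_in_AR[OF m(3)]
  obtain h where h: "\<And>a b c. det3 (a, b, c) (\<rho> 1) (\<rho> 2) = h * (a * dx f + b * dy f + c * dz f)"
    using det3_syzygies[OF primitive_grad gens] by blast
  obtain t where t: "det3 t (\<rho> 1) (\<rho> 2) \<noteq> 0"
    using det3_gens by blast
  have "\<exists>k. homogeneous k h \<and> k + (d - 1) = e 1 + e 2"
  proof -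
    obtain a b c a' b' c' where ab: "\<rho> 1 = (a, b, c)" "\<rho> 2 = (a', b', c')"
      by (metis prod_cases3)
    have hom_gens: "homogeneous (e 1) a" "homogeneous (e 1) b" "homogeneous (e 1) c"
      "homogeneous (e 2) a'" "homogeneous (e 2) b'" "homogeneous (e 2) c'"
      using hom[OF m(2)] hom[OF m(3)] unfolding ab homogeneous3_def by simp_all
    have "h * dx f = b * c' - c * b'" "h * dy f = c * a' - a * c'" "h * dz f = a * b' - b * a'"
      using h[of 1 0 0] h[of 0 1 0] h[of 0 0 1] unfolding ab by (simp_all add: det3_def)
    then have prods: "homogeneous (e 1 + e 2) (h * dx f)" "homogeneous (e 1 + e 2) (h * dy f)"
      "homogeneous (e 1 + e 2) (h * dz f)"
      using hom_gens by (simp_all add: homogeneous_diff homogeneous_mult)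
    have "h \<noteq> 0" "dx f \<noteq> 0 \<or> dy f \<noteq> 0 \<or> dz f \<noteq> 0"
      using t h by (cases t, auto)+
    then show ?thesis
      using prods[THEN homogeneous_cofactor] homogeneous_dx[OF f(1)] homogeneous_dy[OF f(1)]
        homogeneous_dz[OF f(1)] by blast
  qed
  then obtain s where s: "homogeneous s h" "s + (d - 1) = e 1 + e 2" by blast
  have "h \<noteq> 0"
    using t h by (cases t) auto
  obtain \<alpha> \<beta> where shear: "restrict_x (shear \<alpha> \<beta> (det3 t (\<rho> 1) (\<rho> 2))) \<noteq> 0"
    using exists_shear_restrict_x_nonzero[OF t] by blast
  define \<Xi> where "\<Xi> = shear \<alpha> \<beta>"
  \<comment> \<open>The inverse change of coordinates, which carries relations back to
    AR(f).\<close>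
  define \<Theta> where "\<Theta> = shear (- \<alpha>) (- \<beta>)"
  interpret \<Xi>: ring_map \<Xi> unfolding \<Xi>_def by (rule ring_map_shear)
  interpret \<Theta>: ring_map \<Theta> unfolding \<Theta>_def by (rule ring_map_shear)
  have inv: "\<Xi> (\<Theta> p) = p" "\<Theta> (\<Xi> p) = p" for p
    by (simp_all add: \<Xi>_def \<Theta>_def shear_shear_uminus shear_uminus_shear)
  have inv3: "map3 \<Xi> (map3 \<Theta> x) = x" "map3 \<Theta> (map3 \<Xi> x) = x" for x
    by (cases x; simp add: map3_def inv)+
  have m3: "map3 \<Theta> (x + y) = map3 \<Theta> x + map3 \<Theta> y" "map3 \<Theta> 0 = 0"
      "map3 \<Theta> (scale3 c x) = scale3 (\<Theta> c) (map3 \<Theta> x)"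
      "map3 \<Theta> (\<Sum>i\<in>I. z i) = (\<Sum>i\<in>I. map3 \<Theta> (z i))"
    for x y c and z :: "nat \<Rightarrow> _" and I
    by (simp_all add: map3_add map3_zero map3_scale3 map3_sum \<Theta>.ring_map_axioms)
  have "\<forall>j. \<exists>u. j \<in> {3..m} \<longrightarrow> (\<forall>a b c. det3 (a, b, c) (\<rho> 1) (\<rho> j) = u * (a * dx f + b * dy f + c * dz f))"
    using det3_syzygies[OF primitive_grad gens(1) gen_in_AR] by fastforce
  \<comment> \<open>\<open>u j\<close> represents the image of \<open>\<rho> j\<close> under the
    embedding into S / (h).\<close>
  then obtain u where u: "\<And>j a b c. j \<in> {3..m} \<Longrightarrow>
      det3 (a, b, c) (\<rho> 1) (\<rho> j) = u j * (a * dx f + b * dy f + c * dz f)"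
    by metis
  have "m - 2 \<le> s"
  proof (rule ccontr)
    assume "\<not> m - 2 \<le> s"
    then have "degree (\<Xi> h) < card {3..m}"
      using degree_shear_le[OF s(1), of \<alpha> \<beta>] by (simp add: \<Xi>_def)
    moreover have "\<Xi> h \<noteq> 0"
      using inv(2)[of h] \<open>h \<noteq> 0\<close> by (metis \<Theta>.zero)
    ultimately obtain r where r: "\<exists>j\<in>{3..m}. r j \<noteq> 0" "\<Xi> h dvd (\<Sum>j = 3..m. [:r j:] * \<Xi> (u j))"
      using exists_combination_dvd[of "{3..m}" "\<Xi> h" "\<lambda>j. \<Xi> (u j)"] by auto
    then obtain q where q: "(\<Sum>j = 3..m. [:r j:] * \<Xi> (u j)) = \<Xi> h * q" by blast
    have q': "(\<Sum>j = 3..m. \<Theta> [:r j:] * u j) = h * \<Theta> q"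
      using arg_cong[OF q, of \<Theta>] by (simp only: \<Theta>.sum \<Theta>.mult inv)
    \<comment> \<open>The multiple of \<open>\<rho> 2\<close> is chosen so that the cross product of
      \<open>\<rho> 1\<close> with \<open>x\<close> vanishes; hence \<open>x\<close> is a multiple
      of \<open>\<rho> 1\<close>.\<close>
    define x where "x = (\<Sum>j = 3..m. scale3 (\<Theta> [:r j:]) (\<rho> j)) - scale3 (\<Theta> q) (\<rho> 2)"
    have "det3 (a, b, c) (\<rho> 1) x = 0" for a b c
    proof -
      have "det3 (a, b, c) (\<rho> 1) x =
          (\<Sum>j = 3..m. \<Theta> [:r j:] * (u j * (a * dx f + b * dy f + c * dz f))) -
          \<Theta> q * (h * (a * dx f + b * dy f + c * dz f))"
        unfolding x_def det3_diff det3_sum det3_scale3 h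
        by (simp add: u del: One_nat_def)
      also have "\<dots> = ((\<Sum>j = 3..m. \<Theta> [:r j:] * u j) - h * \<Theta> q) * (a * dx f + b * dy f + c * dz f)"
        by (simp only: left_diff_distrib sum_distrib_right mult.assoc mult.left_commute[of "\<Theta> q"])
      finally show ?thesis by (simp add: q')
    qed
    then have "det3 t (\<rho> 1) x = 0" for t
      by (cases t) simp
    from parallel_imp_multiple[OF primitive_gen1 this] obtain a where "x = scale3 a (\<rho> 1)" ..
    then have "(\<Sum>j = 3..m. scale3 (\<Theta> [:r j:]) (\<rho> j)) = scale3 a (\<rho> 1) + scale3 (\<Theta> q) (\<rho> 2)"
      by (simp add: x_def algebra_simps)
    from arg_cong[OF this, of "map3 \<Xi>"]
    have rel: "(\<Sum>j = 3..m. scale3 [:r j:] (map3 \<Xi> (\<rho> j))) =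
        scale3 (\<Xi> a) (map3 \<Xi> (\<rho> 1)) + scale3 q (map3 \<Xi> (\<rho> 2))"
      by (simp add: map3_add map3_scale3 map3_sum \<Xi>.ring_map_axioms inv)
    \<comment> \<open>The image of AR(f) under \<open>\<Xi>\<close>, applied entry by entry.\<close>
    define A where "A = {x. map3 \<Theta> x \<in> AR f}"
    have "\<forall>j\<in>{3..m}. r j = 0"
    proof (rule independent_over_vary_varz[where A = A, OF _ _ _ _ _ _ _ rel])
      show "S3.subspace A"
        using subspace_AR[of f] by (auto simp: A_def S3.subspace_def m3)
      show "x \<in> A" if "scale3 varz x \<in> A" for x
      proof -
        obtain x1 x2 x3 where x: "map3 \<Theta> x = (x1, x2, x3)" by (metis prod_cases3)
        have "scale3 (\<Theta> varz) (x1, x2, x3) \<in> AR f"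
          using that unfolding A_def mem_Collect_eq m3 x .
        then have "\<Theta> varz * (x1 * dx f + x2 * dy f + x3 * dz f) = 0"
          by (simp add: scale3_def AR_def algebra_simps)
        moreover have "\<Theta> varz \<noteq> 0"
          using inv(1)[of varz] by (auto simp: \<Xi>.zero varz_def)
        ultimately show ?thesis
          by (simp add: A_def x AR_def)
      qed
      show "map3 \<Xi> (\<rho> 1) \<in> A" "map3 \<Xi> (\<rho> 2) \<in> A"
        using gens by (simp_all add: A_def inv3)
      show "restrict_x (det3 (map3 \<Xi> t) (map3 \<Xi> (\<rho> 1)) (map3 \<Xi> (\<rho> 2))) \<noteq> 0"
        unfolding det3_map3[OF \<Xi>.ring_map_axioms] using shear by (simp add: \<Xi>_def)
      show "map3 \<Xi> (\<rho> j) \<in> A" if "j \<in> {3..m}" for j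
        using gen_in_AR[of j] that by (simp add: A_def inv3)
      fix c y z a b
      assume y: "y \<in> A" and z: "z \<in> A" and
        eq: "(\<Sum>j = 3..m. scale3 (const3 (c j)) (map3 \<Xi> (\<rho> j))) =
          scale3 vary y + scale3 varz z + scale3 a (map3 \<Xi> (\<rho> 1)) + scale3 b (map3 \<Xi> (\<rho> 2))"
      have "(\<Sum>j = 3..m. scale3 (const3 (c j)) (\<rho> j)) =
          scale3 (\<Theta> vary) (map3 \<Theta> y) + scale3 (\<Theta> varz) (map3 \<Theta> z) + scale3 (\<Theta> a) (\<rho> 1) + scale3 (\<Theta> b) (\<rho> 2)"
        using arg_cong[OF eq, of "map3 \<Theta>"]
        by (simp add: m3 inv3) (simp add: \<Theta>_def shear_simps)
      \<comment> \<open>The inverse shear sends y and z to linear forms, which have no constant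
        term.\<close>
      moreover have "coeff3 (\<Theta> vary) 0 0 0 = 0" "coeff3 (\<Theta> varz) 0 0 0 = 0"
        unfolding \<Theta>_def shear_simps
        by (simp_all add: coeff3_def vary_def varz_def varx_def const3_def)
      ultimately show "\<forall>j\<in>{3..m}. c j = 0"
        using y z generators_independent_modulo[OF m(1)] unfolding A_def by blast
    qed
    with r(1) show False by blast
  qed
  with s(2) m(1) d_pos show ?thesis by linarith
qed

end

theorem proposition2p1:
  fixes f :: S and d m :: nat and e :: "nat \<Rightarrow> nat"
  assumes "d \<ge> 3"
    and "homogeneous d f"
    and "squarefree f"
    and "syzygy_curve f m e"
    and "1 \<le> e 1"
  shows "int m \<le> int (e 1) + int (e 2) - int d + 3 \<and>
         int (e 1) + int (e 2) - int d + 3 \<le> int (e 1) + 2 \<and>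
         int (e 1) + 2 \<le> int d + 1"
proof -
  obtain \<rho> where \<rho>: "inj_on \<rho> {1..m}" "minimal_homogeneous_generators f (\<rho> ` {1..m})"
    "\<forall>j\<in>{1..m}. homogeneous3 (e j) (\<rho> j)" "mono_on {1..m} e"
    using assms(4) unfolding syzygy_curve_def by blast
  have "syzygy_generators f d m e \<rho>"
    using \<rho>(2) unfolding minimal_homogeneous_generators_def
    by (intro syzygy_generators.intro) (use assms \<rho> in auto)
  then interpret syzygy_generators f d m e \<rho> .
  \<comment> \<open>The second inequality amounts to e 2 \<le> d - 1, the third to e 1 \<le> d -
    1.\<close>
  show ?thesis
    using number_of_generators_bound two_generators e1_le_e2 assms(1) by linarith
qed

end
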